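(* Let $p_{\mathrm{obs}}$ and $p_{\mathrm{tgt}}$ be two joint probability distributions of $(X,K,Y,C)$, where $Y=(Y_1,\dots,Y_m)$, having the same marginal distribution $p(x,k)$ of $(X,K)$. Assume that $0\le L(c;\theta)\le L_{\max}$ for all $c$, and that, conditioned on $(X,K)$, the distributions of $C$ under $p_{\mathrm{obs}}$ and $p_{\mathrm{tgt}}$ differ only through $Y$; that is, there is a common Markov kernel $p(c\mid x,k,y)$ which is the conditional distribution of $C$ given $(X,K,Y)$ under both $p_{\mathrm{obs}}$ and $p_{\mathrm{tgt}}$. Let $L_{\mathrm{train}}(\theta)=\mathbb{E}_{\mathrm{obs}}[L(C;\theta)]$ and $L_{\mathrm{tgt}}(\theta)=\mathbb{E}_{\mathrm{tgt}}[L(C;\theta)]$. Then $$\big|L_{\mathrm{tgt}}(\theta)-L_{\mathrm{train}}(\theta)\big|\le 2L_{\max}\sqrt{\tfrac12\,\mathbb{E}_{X,K}\Big[D_{\mathrm{KL}}\big(p_{\mathrm{obs}}(Y\mid X,K)\,\big\|\,p_{\mathrm{tgt}}(Y\mid X,K)\big)\Big]}.$$ Moreover, if the channels $Y_1,\dots,Y_m$ are conditionally independent given $(X,K)$ (under both $p_{\mathrm{obs}}$ and $p_{\mathrm{tgt}}$), then the joint divergence decomposes into the sum of the channel divergences, $$D_{\mathrm{KL}}\big(p_{\mathrm{obs}}(Y\mid X,K)\,\big\|\,p_{\mathrm{tgt}}(Y\mid X,K)\big)=\sum_{j=1}^m CI_{Y_j}(X,K),$$ and hence $$\big|L_{\mathrm{tgt}}(\theta)-L_{\mathrm{train}}(\theta)\big|\le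 2L_{\max}\sqrt{\tfrac12\,\mathbb{E}_{X,K}\Big[\sum_{j=1}^m CI_{Y_j}(X,K)\Big]}.$$
   Context: All random variables take values in standard Borel spaces (e.g. finite or countable sets), so that regular conditional distributions exist. $X$ is a context variable, $K$ a ranking position, $Y=(Y_1,\dots,Y_m)$ a vector of "bias channels", and $C$ the observed click. $p_{\mathrm{obs}}$ (logging mechanism) and $p_{\mathrm{tgt}}$ (target mechanism) are two probability laws on the same variables; $\mathbb{E}_{\mathrm{obs}}$, $\mathbb{E}_{\mathrm{tgt}}$ are the corresponding expectations, and $\mathbb{E}_{X,K}$ is expectation under the common law $p(x,k)$ of $(X,K)$. $\theta$ is a fixed parameter and $c\mapsto L(c;\theta)$ is a measurable real-valued loss. $D_{\mathrm{KL}}(P\|Q)\in[0,\infty]$ is the Kullback--Leibler divergence with natural logarithm (bounds with right-hand side $+\infty$ are trivially true). The channel divergence of $Y_j$ is $$CI_{Y_j}(x,k):=D_{\mathrm{KL}}\big(p_{\mathrm{obs}}(Y_j\mid X=x,K=k)\,\big\|\,p_{\mathrm{tgt}}(Y_j\mid X=x,K=k)\big).$$ Equalities between functions of $(X,K)$ are understood almost surely. *)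

theory Defs
  imports "HOL-Probability.Probability"
begin

definition standard_borel :: "'a measure \<Rightarrow> bool" where
  "standard_borel M \<longleftrightarrow>
     (\<exists>T. completely_metrizable_space T \<and> second_countable T \<and>
          space M = topspace T \<and> sets M = sigma_sets (topspace T) {U. openin T U})"

text \<open>\<open>regular_cond_distr P MZ Z MV V \<kappa>\<close>: the Markov kernel \<open>\<kappa>\<close> from \<open>MZ\<close> to \<open>MV\<close> is a version
  of the conditional distribution of \<open>V\<close> given \<open>Z\<close> under the law \<open>P\<close>.\<close>

definition regular_cond_distr ::
  "'w measure \<Rightarrow> 'z measure \<Rightarrow> ('w \<Rightarrow> 'z) \<Rightarrow> 'v measure \<Rightarrow> ('w \<Rightarrow> 'v) \<Rightarrow> ('z \<Rightarrow> 'v measure) \<Rightarrow> bool" where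
  "regular_cond_distr P MZ Z MV V \<kappa> \<longleftrightarrow>
     \<kappa> \<in> measurable MZ (prob_algebra MV) \<and>
     (\<forall>A\<in>sets MZ. \<forall>B\<in>sets MV.
        emeasure P {w\<in>space P. Z w \<in> A \<and> V w \<in> B} =
          (\<integral>\<^sup>+z. emeasure (\<kappa> z) B * indicator A z \<partial>(distr P MZ Z)))"

text \<open>Conditional independence of the family \<open>(V i)\<close>, \<open>i \<in> I\<close>, given \<open>Z\<close>: conditional
  probabilities given \<open>\<sigma>(Z)\<close> factorise, where the exceptional null set may depend on the events.\<close>

definition cond_indep_vars ::
  "'w measure \<Rightarrow> 'z measure \<Rightarrow> ('w \<Rightarrow> 'z) \<Rightarrow> ('i \<Rightarrow> 'v measure) \<Rightarrow> ('i \<Rightarrow> 'w \<Rightarrow> 'v) \<Rightarrow> 'i set \<Rightarrow> bool" where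
  "cond_indep_vars P MZ Z MV V I \<longleftrightarrow>
     (\<forall>J\<subseteq>I. finite J \<longrightarrow> (\<forall>A. (\<forall>j\<in>J. A j \<in> sets (MV j)) \<longrightarrow>
        (AE w in P.
           real_cond_exp P (vimage_algebra (space P) Z MZ)
             (indicator {w\<in>space P. \<forall>j\<in>J. V j w \<in> A j}) w =
           (\<Prod>j\<in>J. real_cond_exp P (vimage_algebra (space P) Z MZ)
             (indicator {w\<in>space P. V j w \<in> A j}) w))))"

text \<open>Kullback--Leibler divergence \<open>D(P \<parallel> Q)\<close> of probability measures on the same
  \<open>\<sigma>\<close>-algebra, with natural logarithm and values in \<open>[0, \<infinity>]\<close>.  The library constant
  \<^const>\<open>KL_divergence\<close> takes the reference measure \<open>Q\<close> first and is a real-valued Bochner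
  integral, hence not meaningful when \<open>P\<close> is not absolutely continuous with respect to \<open>Q\<close>
  or when the log-likelihood ratio is not \<open>P\<close>-integrable.  Its negative part is always
  \<open>P\<close>-integrable, so in both cases the divergence is \<open>\<infinity>\<close>.\<close>

definition KL_div :: "'a measure \<Rightarrow> 'a measure \<Rightarrow> ennreal" where
  "KL_div P Q =
     (if absolutely_continuous Q P \<and> integrable P (entropy_density (exp 1) Q P)
      then ennreal (KL_divergence (exp 1) Q P) else \<infinity>)"

definition ennreal_sqrt :: "ennreal \<Rightarrow> ennreal" where
  "ennreal_sqrt x = (if x = \<infinity> then \<infinity> else ennreal (sqrt (enn2real x)))"

end

theory Submission
  imports Defs
begin

text \<open>Averaging the loss over the common kernel \<open>p(c | x, k, y)\<close> gives a function \<open>H(x, k, y)\<close>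
  with values in \<open>[0, L\<^sub>m\<^sub>a\<^sub>x]\<close>, so the loss gap is the mean over \<open>(X, K)\<close> of the differences of the
  means of \<open>H\<close> under the two conditional laws of \<open>Y\<close>. The Donsker--Varadhan bound and
  Hoeffding's lemma give Pinsker's inequality for each difference; Jensen's inequality moves the
  square outside. For the decomposition, conditional independence and
  countable generators of the \<open>\<sigma>\<close>-algebras make the joint kernel almost surely the product of
  the channel kernels, and the log-likelihood ratio of product measures is a sum. Integrability of
  that sum forces integrability of each summand because negative parts are always integrable.\<close>

section \<open>Bounds by the Kullback--Leibler divergence\<close>

text \<open>The Radon-Nikodym derivative is unique up to \<open>Q\<close>-null sets, and the set
  where \<open>D\<close> vanishes carries no mass under \<open>density Q D\<close>. Hence the
  abstract density may be replaced by \<open>ln (D x)\<close> with a positive argument, which all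
  later pointwise estimates use.\<close>

lemma entropy_density_density:
  fixes D :: "'a \<Rightarrow> real"
  assumes Q: "prob_space Q" and D[measurable]: "D \<in> borel_measurable Q" and nn: "\<And>x. 0 \<le> D x"
  shows "AE x in density Q D. 0 < D x \<and> entropy_density (exp 1) Q (density Q D) x = ln (D x)"
proof -
  interpret prob_space Q by fact
  have "density Q (RN_deriv Q (density Q D)) = density Q D"
    by (intro density_RN_deriv_density) auto
  then have "AE x in Q. RN_deriv Q (density Q D) x = D x"
    by (intro density_unique) auto
  then show ?thesis
    using nn by (subst AE_density) (auto simp: entropy_density_def log_def ennreal_less_zero_iff less_le)
qed

text \<open>Absolute continuity is automatic for a density, so integrability of the log-likelihood
  ratio alone decides whether the divergence is finite. This frees the later proofs from
  \<open>RN_deriv\<close>.\<close>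

lemma KL_div_density:
  fixes D :: "'a \<Rightarrow> real"
  assumes Q: "prob_space Q" and D[measurable]: "D \<in> borel_measurable Q" and nn: "\<And>x. 0 \<le> D x"
  shows "KL_div (density Q D) Q =
    (if integrable (density Q D) (\<lambda>x. ln (D x)) then ennreal (\<integral>x. ln (D x) \<partial>density Q D) else \<infinity>)"
proof -
  interpret prob_space Q by fact
  have ac: "absolutely_continuous Q (density Q D)"
    by (rule absolutely_continuousI_density) simp
  have ae: "AE x in density Q D. entropy_density (exp 1) Q (density Q D) x = ln (D x)"
    using entropy_density_density[OF assms] by auto
  have m: "entropy_density (exp 1) Q (density Q D) \<in> borel_measurable (density Q D)"
    by measurable
  have "integrable (density Q D) (entropy_density (exp 1) Q (density Q D)) \<longleftrightarrow>
      integrable (density Q D) (\<lambda>x. ln (D x))"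
    by (rule integrable_cong_AE) (use ae m in auto)
  moreover have "KL_divergence (exp 1) Q (density Q D) = (\<integral>x. ln (D x) \<partial>density Q D)"
    unfolding KL_divergence_def by (rule integral_cong_AE) (use ae m in auto)
  ultimately show ?thesis using ac by (simp add: KL_div_def)
qed

text \<open>Finiteness of \<open>P\<close> makes the Radon-Nikodym derivative finite almost
  everywhere. The density lemmas take a real version that is nonnegative everywhere, not just almost
  everywhere.\<close>

lemma absolutely_continuous_densityE:
  assumes "prob_space Q" "prob_space P" "absolutely_continuous Q P" "sets P = sets Q"
  obtains D :: "'a \<Rightarrow> real" where "D \<in> borel_measurable Q" "\<And>x. 0 \<le> D x" "P = density Q D"
proof -
  interpret prob_space Q by fact
  interpret P: prob_space P by fact
  have "finite_measure P" by unfold_locales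
  from real_RN_deriv[OF this assms(3,4)] obtain D
    where D: "D \<in> borel_measurable Q" "AE x in Q. RN_deriv Q P x = ennreal (D x)" "\<And>x. 0 \<le> D x"
    by metis
  have "P = density Q (RN_deriv Q P)" using density_RN_deriv[OF assms(3,4)] by simp
  also have "\<dots> = density Q D" by (rule density_cong) (use D in auto)
  finally show ?thesis using D that by blast
qed

text \<open>The factor \<open>D x\<close> cancels where it is positive. Where \<open>D x = 0\<close>
  the left integrand vanishes, so the part of \<open>Q\<close> living there is lost and an
  inequality remains.\<close>

lemma nn_integral_exp_divide_density_le:
  fixes D :: "'a \<Rightarrow> real"
  assumes [measurable]: "D \<in> borel_measurable Q" "g \<in> borel_measurable Q" and nn: "\<And>x. 0 \<le> D x"
  shows "(\<integral>\<^sup>+x. ennreal (exp (g x) / D x) \<partial>density Q D) \<le> (\<integral>\<^sup>+x. ennreal (exp (g x)) \<partial>Q)"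
proof -
  have "(\<integral>\<^sup>+x. ennreal (exp (g x) / D x) \<partial>density Q D) = (\<integral>\<^sup>+x. ennreal (D x) * ennreal (exp (g x) / D x) \<partial>Q)"
    by (rule nn_integral_density) auto
  also have "\<dots> \<le> (\<integral>\<^sup>+x. ennreal (exp (g x)) \<partial>Q)"
    by (intro nn_integral_mono) (auto simp: ennreal_mult'[symmetric] nn)
  finally show ?thesis .
qed

text \<open>The case \<open>g = 0\<close> of the preceding estimate bounds the integral by the mass
  of \<open>Q\<close>. The function \<open>1 / D\<close> serves as a majorant of the negative part
  of \<open>ln D\<close> when product measures are treated.\<close>

lemma integrable_inverse_density:
  fixes D :: "'a \<Rightarrow> real"
  assumes "prob_space Q" and [measurable]: "D \<in> borel_measurable Q" and nn: "\<And>x. 0 \<le> D x"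
  shows "integrable (density Q D) (\<lambda>x. 1 / D x)"
proof (rule integrableI_nonneg)
  interpret prob_space Q by fact
  show "(\<integral>\<^sup>+x. ennreal (1 / D x) \<partial>density Q D) < \<infinity>"
    using nn_integral_exp_divide_density_le[of D Q "\<lambda>_. 0"] nn
    by (auto simp: emeasure_space_1 intro: le_less_trans)
qed (use nn in auto)

text \<open>The Donsker--Varadhan bound, integrated from the pointwise inequality
  \<open>1 + g - ln D \<le> exp g / D\<close>.\<close>

lemma integral_le_integral_ln_density:
  fixes D g :: "'a \<Rightarrow> real"
  assumes Q: "prob_space Q" and P: "prob_space (density Q D)"
    and D[measurable]: "D \<in> borel_measurable Q" and nn: "\<And>x. 0 \<le> D x"
    and ln: "integrable (density Q D) (\<lambda>x. ln (D x))"
    and g[measurable]: "g \<in> borel_measurable Q" and ig: "integrable (density Q D) g"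
    and le: "(\<integral>\<^sup>+x. ennreal (exp (g x)) \<partial>Q) \<le> 1"
  shows "(\<integral>x. g x \<partial>density Q D) \<le> (\<integral>x. ln (D x) \<partial>density Q D)"
proof -
  interpret P: prob_space "density Q D" by fact
  let ?P = "density Q D"
  have nle: "(\<integral>\<^sup>+x. ennreal (exp (g x) / D x) \<partial>?P) \<le> 1"
    using nn_integral_exp_divide_density_le[OF D g nn] le by (rule order_trans)
  have int: "integrable ?P (\<lambda>x. exp (g x) / D x)"
    by (rule integrableI_nonneg) (use nn in \<open>auto intro: le_less_trans[OF nle]\<close>)
  have "ennreal (\<integral>x. exp (g x) / D x \<partial>?P) \<le> ennreal 1"
    using nle by (subst nn_integral_eq_integral[symmetric]) (use nn int in auto)
  then have le1: "(\<integral>x. exp (g x) / D x \<partial>?P) \<le> 1"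
    by simp
  have "(\<integral>x. 1 + g x - ln (D x) \<partial>?P) \<le> (\<integral>x. exp (g x) / D x \<partial>?P)"
  proof (rule integral_mono_AE)
    show "AE x in ?P. 1 + g x - ln (D x) \<le> exp (g x) / D x"
      using entropy_density_density[OF Q D nn]
    proof eventually_elim
      case (elim x)
      have "1 + (g x - ln (D x)) \<le> exp (g x - ln (D x))" by (rule exp_ge_add_one_self)
      then show ?case using elim by (simp add: exp_diff)
    qed
  qed (use ln ig int in auto)
  also have "(\<integral>x. 1 + g x - ln (D x) \<partial>?P) = 1 + (\<integral>x. g x \<partial>?P) - (\<integral>x. ln (D x) \<partial>?P)"
    using ln ig by (simp add: P.prob_space[simplified])
  finally show ?thesis using le1 by simp
qed

text \<open>The choice \<open>g = 0\<close> in the variational bound; this is Gibbs'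
  inequality.\<close>

lemma integral_ln_density_nonneg:
  fixes D :: "'a \<Rightarrow> real"
  assumes "prob_space Q" "prob_space (density Q D)" "D \<in> borel_measurable Q" "\<And>x. 0 \<le> D x"
    and "integrable (density Q D) (\<lambda>x. ln (D x))"
  shows "0 \<le> (\<integral>x. ln (D x) \<partial>density Q D)"
proof -
  have "(\<integral>x. 0 \<partial>density Q D) \<le> (\<integral>x. ln (D x) \<partial>density Q D)"
    by (rule integral_le_integral_ln_density[OF assms]) (auto simp: prob_space.emeasure_space_1[OF assms(1)])
  then show ?thesis by simp
qed

text \<open>The test function is the centred \<open>l * h\<close> minus the exponent
  \<open>l\<^sup>2 * (b - a)\<^sup>2 / 8\<close> of Hoeffding's lemma, so its exponential has mean
  at most 1 under \<open>Q\<close> and the variational bound applies. Negative slopes are reached by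
  passing from \<open>h\<close> to \<open>- h\<close>.\<close>

lemma mean_difference_le_KL:
  fixes D h :: "'a \<Rightarrow> real"
  assumes Q: "prob_space Q" and P: "prob_space (density Q D)"
    and D[measurable]: "D \<in> borel_measurable Q" and nn: "\<And>x. 0 \<le> D x"
    and ln: "integrable (density Q D) (\<lambda>x. ln (D x))"
    and h[measurable]: "h \<in> borel_measurable Q" and ab: "\<And>x. x \<in> space Q \<Longrightarrow> h x \<in> {a..b}"
    and l: "0 < l"
  shows "l * ((\<integral>x. h x \<partial>density Q D) - (\<integral>x. h x \<partial>Q)) \<le>
    (\<integral>x. ln (D x) \<partial>density Q D) + l\<^sup>2 * (b - a)\<^sup>2 / 8"
proof -
  interpret Q: prob_space Q by fact
  interpret P: prob_space "density Q D" by fact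
  interpret interval_bounded_random_variable Q h a b
    by unfold_locales (use ab in auto)
  let ?c = "l\<^sup>2 * (b - a)\<^sup>2 / 8"
  define g where "g x = l * (h x - (\<integral>x. h x \<partial>Q)) - ?c" for x
  have ih: "integrable (density Q D) h"
    by (rule P.integrable_const_bound[where B="max \<bar>a\<bar> \<bar>b\<bar>"])
       (use ab in \<open>force intro!: AE_I2 simp: abs_le_iff\<close>)+
  have [measurable]: "g \<in> borel_measurable Q" unfolding g_def by measurable
  have ig: "integrable (density Q D) g"
    unfolding g_def using ih by (intro Bochner_Integration.integrable_diff integrable_mult_right) auto
  have "(\<integral>\<^sup>+x. ennreal (exp (g x)) \<partial>Q) = (\<integral>\<^sup>+x. ennreal (exp (l * (h x - (\<integral>x. h x \<partial>Q)))) * ennreal (exp (- ?c)) \<partial>Q)"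
    by (intro nn_integral_cong) (simp add: g_def ennreal_mult'[symmetric] exp_add[symmetric])
  also have "\<dots> = (\<integral>\<^sup>+x. ennreal (exp (l * (h x - (\<integral>x. h x \<partial>Q)))) \<partial>Q) * ennreal (exp (- ?c))"
    by (rule nn_integral_multc) auto
  also have "\<dots> \<le> ennreal (exp ?c) * ennreal (exp (- ?c))"
    by (intro mult_right_mono Hoeffdings_lemma_nn_integral l) simp
  also have "\<dots> = 1"
    by (simp add: ennreal_mult'[symmetric] exp_add[symmetric])
  finally have "(\<integral>x. g x \<partial>density Q D) \<le> (\<integral>x. ln (D x) \<partial>density Q D)"
    using ig by (intro integral_le_integral_ln_density assms) auto
  also have "(\<integral>x. g x \<partial>density Q D) = l * ((\<integral>x. h x \<partial>density Q D) - (\<integral>x. h x \<partial>Q)) - ?c"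
    unfolding g_def using ih by (simp add: P.prob_space[simplified])
  finally show ?thesis by simp
qed

text \<open>The bound of \<open>mean_difference_le_KL\<close> is quadratic in \<open>l\<close>;
  optimising over \<open>l\<close>, for \<open>h\<close> and for \<open>- h\<close>, produces the
  squared mean difference. Without absolute continuity or integrability of the log-likelihood ratio
  the right side is infinite.\<close>

lemma Pinsker_bounded:
  fixes h :: "'a \<Rightarrow> real"
  assumes P: "prob_space P" and Q: "prob_space Q" and sets: "sets P = sets Q"
    and h[measurable]: "h \<in> borel_measurable Q" and B: "\<And>x. x \<in> space Q \<Longrightarrow> 0 \<le> h x \<and> h x \<le> B"
    and B0: "0 < B"
  shows "ennreal (2 * ((\<integral>x. h x \<partial>P) - (\<integral>x. h x \<partial>Q))\<^sup>2 / B\<^sup>2) \<le> KL_div P Q"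
proof (cases "absolutely_continuous Q P")
  case True
  from absolutely_continuous_densityE[OF Q P True sets] obtain D :: "'a \<Rightarrow> real"
    where D: "D \<in> borel_measurable Q" "\<And>x. 0 \<le> D x" and PD: "P = density Q D" by blast
  let ?K = "\<integral>x. ln (D x) \<partial>density Q D" and ?d = "(\<integral>x. h x \<partial>P) - (\<integral>x. h x \<partial>Q)"
  show ?thesis
  proof (cases "integrable (density Q D) (\<lambda>x. ln (D x))")
    case True
    have "2 * ?d\<^sup>2 / B\<^sup>2 \<le> ?K"
    proof (cases "?d = 0")
      case True
      then show ?thesis
        using integral_ln_density_nonneg[OF Q P[unfolded PD] D \<open>integrable _ _\<close>] by simp
    next
      case False
      \<comment> \<open>The maximiser of
        \<open>l * \<bar>?d\<bar> - l\<^sup>2 * B\<^sup>2 / 8\<close>, with maximum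
        \<open>2 * ?d\<^sup>2 / B\<^sup>2\<close>. It is positive only for
        \<open>?d \<noteq> 0\<close>, hence the case split.\<close>
      define l where "l = 4 * \<bar>?d\<bar> / B\<^sup>2"
      have l: "0 < l" using False B0 by (simp add: l_def)
      note D_V = mean_difference_le_KL[OF Q P[unfolded PD] D True _ _ l, folded PD]
      have "l * ?d \<le> ?K + l\<^sup>2 * B\<^sup>2 / 8"
        using D_V[of h 0 B] B by (auto simp: PD)
      \<comment> \<open>The values of \<open>- h\<close> lie in an interval of the same length
        \<open>B\<close>, so the error term is the same and the two signs combine to the absolute
        value.\<close>
      moreover have "l * - ?d \<le> ?K + l\<^sup>2 * B\<^sup>2 / 8"
        using D_V[of "\<lambda>x. - h x" "- B" 0] B by (auto simp: PD)
      ultimately have "l * \<bar>?d\<bar> \<le> ?K + l\<^sup>2 * B\<^sup>2 / 8" by (auto simp: abs_if)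
      moreover have "l * \<bar>?d\<bar> = 4 * ?d\<^sup>2 / B\<^sup>2"
        by (simp add: l_def power2_eq_square)
      moreover have "l\<^sup>2 * B\<^sup>2 / 8 = 2 * ?d\<^sup>2 / B\<^sup>2"
        using B0 by (simp add: l_def power2_eq_square field_simps)
      ultimately show ?thesis by simp
    qed
    then show ?thesis
      using True D Q unfolding PD by (subst KL_div_density) (auto simp: PD intro!: ennreal_leI)
  next
    case False
    then show ?thesis unfolding PD using D Q by (subst KL_div_density) auto
  qed
qed (simp add: KL_div_def)

section \<open>Divergence of product measures\<close>

text \<open>On a box the integrand, indicator included, is a product of functions of single
  coordinates, so its integral factorises; boxes determine the product measure. \<open>P\<close> and
  \<open>Q\<close> are probability measures at every index, as the locale
  \<open>product_prob_space\<close> demands.\<close>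

lemma PiM_eq_density:
  fixes D :: "'i \<Rightarrow> 'a \<Rightarrow> real"
  assumes I: "finite I" and P: "\<And>i. prob_space (P i)" and Q: "\<And>i. prob_space (Q i)"
    and D: "\<And>i. i \<in> I \<Longrightarrow> D i \<in> borel_measurable (Q i)" "\<And>i x. i \<in> I \<Longrightarrow> 0 \<le> D i x"
    and PD: "\<And>i. i \<in> I \<Longrightarrow> P i = density (Q i) (D i)"
  shows "PiM I P = density (PiM I Q) (\<lambda>x. \<Prod>i\<in>I. D i (x i))"
proof -
  interpret P: product_prob_space P I
    by (intro product_prob_spaceI P)
  interpret Q: product_prob_space Q I
    by (intro product_prob_spaceI Q)
  note D(1)[measurable]
  have s: "sets (PiM I Q) = sets (PiM I P)"
    by (rule sets_PiM_cong) (auto simp: PD)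
  show ?thesis
  proof (rule P.PiM_eqI[symmetric])
    fix A assume A: "\<And>i. i \<in> I \<Longrightarrow> A i \<in> sets (P i)"
    then have A': "\<And>i. i \<in> I \<Longrightarrow> A i \<in> sets (Q i)" by (simp add: PD)
    then have "emeasure (density (PiM I Q) (\<lambda>x. \<Prod>i\<in>I. D i (x i))) (PiE I A) =
        (\<integral>\<^sup>+x. ennreal (\<Prod>i\<in>I. D i (x i)) * indicator (PiE I A) x \<partial>PiM I Q)"
      using I by (intro emeasure_density) (auto intro!: sets_PiM_I_finite)
    also have "\<dots> = (\<integral>\<^sup>+x. (\<Prod>i\<in>I. ennreal (D i (x i)) * indicator (A i) (x i)) \<partial>PiM I Q)"
    proof (rule nn_integral_cong)
      fix x assume "x \<in> space (PiM I Q)"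
      then have "indicator (PiE I A) x = (\<Prod>i\<in>I. indicator (A i) (x i) :: ennreal)"
        using I by (auto simp: indicator_def PiE_iff space_PiM prod_zero_iff)
      then show "ennreal (\<Prod>i\<in>I. D i (x i)) * indicator (PiE I A) x =
          (\<Prod>i\<in>I. ennreal (D i (x i)) * indicator (A i) (x i))"
        using D(2) by (simp add: prod.distrib prod_ennreal)
    qed
    also have "\<dots> = (\<Prod>i\<in>I. \<integral>\<^sup>+x. ennreal (D i x) * indicator (A i) x \<partial>Q i)"
      using I A' by (intro Q.product_nn_integral_prod) auto
    also have "\<dots> = (\<Prod>i\<in>I. emeasure (P i) (A i))"
      using A' D(1) by (intro prod.cong) (auto simp: PD emeasure_density)
    finally show "emeasure (density (PiM I Q) (\<lambda>x. \<Prod>i\<in>I. D i (x i))) (PiE I A) =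
        (\<Prod>i\<in>I. emeasure (P i) (A i))" .
  qed (use I s in auto)
qed

text \<open>Linearity of the integral settles the finite case. The remaining work is to see that
  both sides become infinite together, that is, that the joint log-likelihood ratio is integrable
  exactly if each summand is.\<close>

lemma KL_div_PiM_density:
  fixes D :: "'i \<Rightarrow> 'a \<Rightarrow> real"
  assumes I: "finite I" and P: "\<And>i. prob_space (P i)" and Q: "\<And>i. prob_space (Q i)"
    and D: "\<And>i. i \<in> I \<Longrightarrow> D i \<in> borel_measurable (Q i)" "\<And>i x. i \<in> I \<Longrightarrow> 0 \<le> D i x"
    and PD: "\<And>i. i \<in> I \<Longrightarrow> P i = density (Q i) (D i)"
  shows "KL_div (PiM I P) (PiM I Q) = (\<Sum>i\<in>I. KL_div (P i) (Q i))"
proof -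
  interpret P: product_prob_space P I
    by (intro product_prob_spaceI P)
  interpret Q: product_prob_space Q I
    by (intro product_prob_spaceI Q)
  note D(1)[measurable]
  have s[measurable_cong]: "sets (PiM I P) = sets (PiM I Q)"
    by (rule sets_PiM_cong) (auto simp: PD)
  let ?D = "\<lambda>x. \<Prod>i\<in>I. D i (x i)"
  have mD: "?D \<in> borel_measurable (PiM I Q)" by measurable
  have lnm: "(\<lambda>x. ln (D i x)) \<in> borel_measurable (P i)" if "i \<in> I" for i
    using D(1)[OF that] by (simp add: PD[OF that])
  have eq: "PiM I P = density (PiM I Q) ?D"
    by (rule PiM_eq_density) (use assms in auto)
  have nn: "0 \<le> (\<Prod>i\<in>I. D i (x i))" for x
    by (rule prod_nonneg) (use D in auto)
  \<comment> \<open>Positivity of every factor lets \<open>ln\<close> turn the product into a sum;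
    it can fail only on a \<open>PiM I P\<close>-null set.\<close>
  have aepos: "AE x in PiM I P. \<forall>i\<in>I. 0 < D i (x i)"
  proof (intro AE_finite_allI I)
    fix i assume i: "i \<in> I"
    have "AE x in P i. 0 < D i x"
      using entropy_density_density[OF Q D[OF i]] unfolding PD[OF i, symmetric] by auto
    then show "AE x in PiM I P. 0 < D i (x i)"
      using i P by (intro AE_PiM_component) auto
  qed
  then have aeln: "AE x in PiM I P. ln (?D x) = (\<Sum>i\<in>I. ln (D i (x i)))"
  proof eventually_elim
    case (elim x)
    show ?case by (rule ln_prod[OF I]) (use elim in force)
  qed
  \<comment> \<open>Coordinate maps push \<open>PiM I P\<close> forward to its factors, so integrals
    of functions of one coordinate reduce to the factors.\<close>
  have tr: "integrable (PiM I P) (\<lambda>x. f (x i)) \<longleftrightarrow> integrable (P i) f"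
      "(\<integral>x. f (x i) \<partial>PiM I P) = (\<integral>x. f x \<partial>P i)"
    if "i \<in> I" and [measurable]: "f \<in> borel_measurable (P i)" for i and f :: "'a \<Rightarrow> real"
  proof -
    have m: "(\<lambda>x. x i) \<in> PiM I P \<rightarrow>\<^sub>M P i" using that by simp
    have d: "distr (PiM I P) (P i) (\<lambda>x. x i) = P i"
      by (rule distr_PiM_component) (use that P in simp_all)
    show "integrable (PiM I P) (\<lambda>x. f (x i)) \<longleftrightarrow> integrable (P i) f"
      using integrable_distr_eq[OF m that(2)] unfolding d by blast
    show "(\<integral>x. f (x i) \<partial>PiM I P) = (\<integral>x. f x \<partial>P i)"
      using integral_distr[OF m that(2)] unfolding d by simp
  qed
  \<comment> \<open>Summands cannot compensate each other: the negative parts \<open>?n j\<close>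
    are integrable on their own, so the integrable sum controls the positive parts
    \<open>ln (D j x) + ?n j x\<close>.\<close>
  have all: "(\<forall>i\<in>I. integrable (P i) (\<lambda>x. ln (D i x)))"
    if int: "integrable (PiM I P) (\<lambda>x. \<Sum>i\<in>I. ln (D i (x i)))"
  proof
    fix i assume i: "i \<in> I"
    let ?n = "\<lambda>j x. max 0 (- ln (D j x))"
    have n: "integrable (PiM I P) (\<lambda>x. ?n j (x j))" if j: "j \<in> I" for j
    proof -
      have "integrable (P j) (?n j)"
      proof (rule Bochner_Integration.integrable_bound)
        show "integrable (P j) (\<lambda>x. 1 / D j x)"
          using integrable_inverse_density[OF Q D[OF j]] unfolding PD[OF j, symmetric] .
        show "AE x in P j. norm (?n j x) \<le> norm (1 / D j x)"
          using entropy_density_density[OF Q D[OF j]] unfolding PD[OF j, symmetric]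
        proof eventually_elim
          case (elim x)
          then have "ln (1 / D j x) \<le> 1 / D j x - 1" by (intro ln_le_minus_one) auto
          moreover have "ln (1 / D j x) = - ln (D j x)" using elim by (simp add: ln_div)
          moreover have "0 < 1 / D j x" using elim by simp
          ultimately show ?case by (simp add: max_def)
        qed
      qed (use lnm[OF j] in measurable)
      then show ?thesis
        using lnm[OF j] by (subst tr(1)[OF j, of "?n j"]) simp_all
    qed
    \<comment> \<open>This is a majorant of the absolute value of the summand \<open>i\<close>: the
      two sums together are the sum of all positive parts, which dominates the positive part of that
      summand, and the last term is its negative part.\<close>
    have "integrable (PiM I P) (\<lambda>x. (\<Sum>i\<in>I. ln (D i (x i))) + (\<Sum>j\<in>I. ?n j (x j)) + ?n i (x i))"
      by (intro Bochner_Integration.integrable_add[OF Bochner_Integration.integrable_add[OF int]] Bochner_Integration.integrable_sum n i)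
    then have "integrable (PiM I P) (\<lambda>x. ln (D i (x i)))"
    proof (rule Bochner_Integration.integrable_bound)
      show "AE x in PiM I P. norm (ln (D i (x i))) \<le>
          norm ((\<Sum>i\<in>I. ln (D i (x i))) + (\<Sum>j\<in>I. ?n j (x j)) + ?n i (x i))"
      proof (rule AE_I2)
        fix x
        let ?p = "\<lambda>j. ln (D j (x j)) + ?n j (x j)"
        have "?p i \<le> (\<Sum>j\<in>I. ?p j)"
          by (rule member_le_sum[OF i _ I]) (simp add: max_def)
        then have "ln (D i (x i)) + ?n i (x i) \<le> (\<Sum>i\<in>I. ln (D i (x i))) + (\<Sum>j\<in>I. ?n j (x j))"
          by (simp only: sum.distrib)
        then show "norm (ln (D i (x i))) \<le>
            norm ((\<Sum>i\<in>I. ln (D i (x i))) + (\<Sum>j\<in>I. ?n j (x j)) + ?n i (x i))"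
          unfolding real_norm_def by linarith
      qed
      show "(\<lambda>x. ln (D i (x i))) \<in> borel_measurable (PiM I P)"
        using i D(1)[OF i] by measurable
    qed
    then show "integrable (P i) (\<lambda>x. ln (D i x))"
      using tr(1)[OF i lnm[OF i]] by simp
  qed
  have mln: "(\<lambda>x. ln (?D x)) \<in> borel_measurable (PiM I P)"
    "(\<lambda>x. \<Sum>i\<in>I. ln (D i (x i))) \<in> borel_measurable (PiM I P)"
    by measurable
  have int_iff: "integrable (PiM I P) (\<lambda>x. ln (?D x)) \<longleftrightarrow>
      (\<forall>i\<in>I. integrable (P i) (\<lambda>x. ln (D i x)))"
  proof
    assume "integrable (PiM I P) (\<lambda>x. ln (?D x))"
    then show "\<forall>i\<in>I. integrable (P i) (\<lambda>x. ln (D i x))"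
      using integrable_cong_AE[OF mln aeln] by (intro all) simp
  next
    assume "\<forall>i\<in>I. integrable (P i) (\<lambda>x. ln (D i x))"
    then have "integrable (PiM I P) (\<lambda>x. \<Sum>i\<in>I. ln (D i (x i)))"
      using tr(1)[OF _ lnm] by (intro Bochner_Integration.integrable_sum) auto
    then show "integrable (PiM I P) (\<lambda>x. ln (?D x))"
      using integrable_cong_AE[OF mln aeln] by simp
  qed
  have KLi: "KL_div (P i) (Q i) =
      (if integrable (P i) (\<lambda>x. ln (D i x)) then ennreal (\<integral>x. ln (D i x) \<partial>P i) else \<infinity>)"
    if "i \<in> I" for i
    using KL_div_density[OF Q D[OF that]] unfolding PD[OF that, symmetric] .
  have KL: "KL_div (PiM I P) (PiM I Q) =
      (if integrable (PiM I P) (\<lambda>x. ln (?D x)) then ennreal (\<integral>x. ln (?D x) \<partial>PiM I P) else \<infinity>)"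
    using KL_div_density[OF Q.prob_space_axioms mD nn] unfolding eq[symmetric] .
  show ?thesis
  proof (cases "\<forall>i\<in>I. integrable (P i) (\<lambda>x. ln (D i x))")
    case True
    have "(\<integral>x. ln (?D x) \<partial>PiM I P) = (\<integral>x. (\<Sum>i\<in>I. ln (D i (x i))) \<partial>PiM I P)"
      by (rule integral_cong_AE[OF mln aeln])
    also have "\<dots> = (\<Sum>i\<in>I. \<integral>x. ln (D i (x i)) \<partial>PiM I P)"
      using True tr(1)[OF _ lnm] by (intro Bochner_Integration.integral_sum) auto
    also have "\<dots> = (\<Sum>i\<in>I. \<integral>x. ln (D i x) \<partial>P i)"
      by (rule sum.cong[OF refl], rule tr(2)[OF _ lnm])
    finally have "KL_div (PiM I P) (PiM I Q) = ennreal (\<Sum>i\<in>I. \<integral>x. ln (D i x) \<partial>P i)"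
      using True KL int_iff by simp
    also have "\<dots> = (\<Sum>i\<in>I. ennreal (\<integral>x. ln (D i x) \<partial>P i))"
    proof (rule sum_ennreal[symmetric])
      fix i assume i: "i \<in> I"
      show "0 \<le> (\<integral>x. ln (D i x) \<partial>P i)"
        using integral_ln_density_nonneg[OF Q _ D[OF i]] P[of i] True i
        unfolding PD[OF i, symmetric] by blast
    qed
    also have "\<dots> = (\<Sum>i\<in>I. KL_div (P i) (Q i))"
      using True KLi by (intro sum.cong) auto
    finally show ?thesis .
  next
    case False
    then obtain i where "i \<in> I" "KL_div (P i) (Q i) = \<infinity>" using KLi by auto
    then have "(\<Sum>i\<in>I. KL_div (P i) (Q i)) = \<infinity>"
      using I by (auto simp: infinity_ennreal_def)
    then show ?thesis using KL int_iff False by simp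
  qed
qed

text \<open>A null set of a factor pulls back along the coordinate map to a null set of the product,
  because the factor is the marginal. Used in contrapositive form: one factor without absolute
  continuity spoils it for the product.\<close>

lemma absolutely_continuous_PiM_component:
  assumes P: "\<And>i. i \<in> I \<Longrightarrow> prob_space (P i)" and Q: "\<And>i. i \<in> I \<Longrightarrow> prob_space (Q i)"
    and sets: "\<And>i. i \<in> I \<Longrightarrow> sets (P i) = sets (Q i)"
    and ac: "absolutely_continuous (PiM I Q) (PiM I P)" and i: "i \<in> I"
  shows "absolutely_continuous (Q i) (P i)"
  unfolding absolutely_continuous_def
proof
  fix A assume A: "A \<in> null_sets (Q i)"
  let ?A = "(\<lambda>x. x i) -` A \<inter> space (PiM I Q)"
  have sp: "space (PiM I Q) = space (PiM I P)"
    by (intro sets_eq_imp_space_eq sets_PiM_cong) (auto simp: sets)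
  have dQ: "distr (PiM I Q) (Q i) (\<lambda>x. x i) = Q i" and dP: "distr (PiM I P) (P i) (\<lambda>x. x i) = P i"
    by (rule distr_PiM_component; use P Q i in simp)+
  have "emeasure (distr (PiM I Q) (Q i) (\<lambda>x. x i)) A = 0"
    using A by (simp add: dQ null_setsD1)
  then have "?A \<in> null_sets (PiM I Q)"
    using A i by (auto simp: emeasure_distr null_sets_def intro!: measurable_sets[of _ _ "Q i"])
  then have "?A \<in> null_sets (PiM I P)"
    using ac by (auto simp: absolutely_continuous_def)
  then have "emeasure (distr (PiM I P) (P i) (\<lambda>x. x i)) A = 0"
    using A i sets[OF i] sp by (auto simp: emeasure_distr null_sets_def)
  then show "A \<in> null_sets (P i)"
    using A sets[OF i] by (simp add: dP null_sets_def)
qed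

text \<open>If all factors are absolutely continuous, they have real densities and the previous
  computation applies. Otherwise absolute continuity also fails for the product, and both sides are
  infinite.\<close>

proposition KL_div_PiM:
  assumes I: "finite I"
    and P: "\<And>i. i \<in> I \<Longrightarrow> prob_space (P i)" and Q: "\<And>i. i \<in> I \<Longrightarrow> prob_space (Q i)"
    and sets: "\<And>i. i \<in> I \<Longrightarrow> sets (P i) = sets (Q i)"
  shows "KL_div (PiM I P) (PiM I Q) = (\<Sum>i\<in>I. KL_div (P i) (Q i))"
proof (cases "\<forall>i\<in>I. absolutely_continuous (Q i) (P i)")
  case True
  have "\<forall>i\<in>I. \<exists>D. D \<in> Q i \<rightarrow>\<^sub>M (borel :: real measure) \<and> (\<forall>x. 0 \<le> D x) \<and> P i = density (Q i) D"
  proof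
    fix i assume i: "i \<in> I"
    show "\<exists>D. D \<in> Q i \<rightarrow>\<^sub>M (borel :: real measure) \<and> (\<forall>x. 0 \<le> D x) \<and> P i = density (Q i) D"
      by (rule absolutely_continuous_densityE[OF Q[OF i] P[OF i] bspec[OF True i] sets[OF i]]) blast
  qed
  from bchoice[OF this] obtain D :: "_ \<Rightarrow> _ \<Rightarrow> real" where
    D: "\<And>i. i \<in> I \<Longrightarrow> D i \<in> borel_measurable (Q i)" "\<And>i x. i \<in> I \<Longrightarrow> 0 \<le> D i x"
      "\<And>i. i \<in> I \<Longrightarrow> P i = density (Q i) (D i)"
    by blast
  \<comment> \<open>Outside \<open>I\<close> the families are arbitrary, while
    \<open>KL_div_PiM_density\<close> wants probability measures at every index. A point mass fills
    the gap and leaves \<open>PiM I\<close> unchanged.\<close>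
  let ?e = "\<lambda>M i. if i \<in> I then M i else return (count_space UNIV) undefined"
  have "KL_div (PiM I (?e P)) (PiM I (?e Q)) = (\<Sum>i\<in>I. KL_div (?e P i) (?e Q i))"
  proof (rule KL_div_PiM_density[OF I, where D=D])
    fix i
    show "prob_space (?e P i)" "prob_space (?e Q i)"
      using P[of i] Q[of i] by (simp_all add: prob_space_return)
  next
    fix i assume i: "i \<in> I"
    show "D i \<in> borel_measurable (?e Q i)" using D(1)[OF i] i by simp
    show "0 \<le> D i x" for x using D(2)[OF i] .
    show "?e P i = density (?e Q i) (D i)" using D(3)[OF i] i by (simp only: if_True)
  qed
  moreover have "PiM I (?e P) = PiM I P" "PiM I (?e Q) = PiM I Q"
    by (rule PiM_cong; simp)+
  ultimately show ?thesis by simp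
next
  case False
  then obtain i where i: "i \<in> I" "\<not> absolutely_continuous (Q i) (P i)" by auto
  then have "\<not> absolutely_continuous (PiM I Q) (PiM I P)"
    using absolutely_continuous_PiM_component[of I P Q i] P Q sets by blast
  then have "KL_div (PiM I P) (PiM I Q) = \<infinity>" by (simp add: KL_div_def)
  moreover have "KL_div (P i) (Q i) = \<infinity>" using i by (simp add: KL_div_def)
  then have "(\<Sum>i\<in>I. KL_div (P i) (Q i)) = \<infinity>"
    using I i by (auto simp: infinity_ennreal_def)
  ultimately show ?thesis by simp
qed

section \<open>Regular conditional distributions\<close>

lemma regular_cond_distr_kernel:
  assumes "regular_cond_distr P MZ Z MV V \<kappa>" and "z \<in> space MZ"
  shows "prob_space (\<kappa> z)" "sets (\<kappa> z) = sets MV"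
  using assms measurable_space[of \<kappa> MZ "prob_algebra MV" z]
  by (auto simp: regular_cond_distr_def space_prob_algebra)

lemma measurable_regular_cond_distr:
  assumes "regular_cond_distr P MZ Z MV V \<kappa>"
  shows "\<kappa> \<in> MZ \<rightarrow>\<^sub>M subprob_algebra MV"
  using assms by (auto simp: regular_cond_distr_def intro: measurable_prob_algebraD)

lemma measurable_kernel_Pair:
  assumes "\<kappa> \<in> MZ \<rightarrow>\<^sub>M subprob_algebra MV"
  shows "(\<lambda>z. distr (\<kappa> z) (MZ \<Otimes>\<^sub>M MV) (Pair z)) \<in> MZ \<rightarrow>\<^sub>M subprob_algebra (MZ \<Otimes>\<^sub>M MV)"
  by (rule measurable_distr2[OF _ assms]) simp

text \<open>The identity defining \<open>regular_cond_distr\<close> is equality of both measures on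
  measurable rectangles, an intersection-stable generator of the product. Lifting the kernel by
  \<open>Pair z\<close> retains the conditioning value, so the bind gives the joint law and not only
  the marginal of \<open>V\<close>.\<close>

lemma distr_Pair_eq_bind:
  assumes P: "prob_space P" and Z[measurable]: "Z \<in> P \<rightarrow>\<^sub>M MZ" and V[measurable]: "V \<in> P \<rightarrow>\<^sub>M MV"
    and \<kappa>: "regular_cond_distr P MZ Z MV V \<kappa>"
  shows "distr P (MZ \<Otimes>\<^sub>M MV) (\<lambda>w. (Z w, V w)) =
    Giry_Monad.bind (distr P MZ Z) (\<lambda>z. distr (\<kappa> z) (MZ \<Otimes>\<^sub>M MV) (Pair z))" (is "?L = ?N")
proof -
  let ?D = "distr P MZ Z" and ?k = "\<lambda>z. distr (\<kappa> z) (MZ \<Otimes>\<^sub>M MV) (Pair z)"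
  interpret P: prob_space P by fact
  interpret L: prob_space ?L by (rule P.prob_space_distr) simp
  note \<kappa>m = measurable_regular_cond_distr[OF \<kappa>]
  have k: "?k \<in> ?D \<rightarrow>\<^sub>M subprob_algebra (MZ \<Otimes>\<^sub>M MV)"
    using measurable_kernel_Pair[OF \<kappa>m] by simp
  have ne: "space ?D \<noteq> {}"
    using P.not_empty measurable_space[OF Z] by auto
  let ?E = "{a \<times> b |a b. a \<in> sets MZ \<and> b \<in> sets MV}"
  show ?thesis
  proof (rule measure_eqI_generator_eq[OF Int_stable_pair_measure_generator[of MZ MV],
        where \<Omega>="space MZ \<times> space MV" and A="\<lambda>_. space MZ \<times> space MV"])
    show "?E \<subseteq> Pow (space MZ \<times> space MV)" using sets.space_closed[of MZ] sets.space_closed[of MV] by auto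
    show "sets ?L = sigma_sets (space MZ \<times> space MV) ?E" by (simp add: sets_pair_measure)
    have "sets ?N = sets (MZ \<Otimes>\<^sub>M MV)" by (rule sets_bind[OF _ ne]) simp
    then show "sets ?N = sigma_sets (space MZ \<times> space MV) ?E"
      by (simp add: sets_pair_measure)
    show "emeasure ?L (space MZ \<times> space MV) \<noteq> \<infinity>" by simp
  next
    fix X assume "X \<in> ?E"
    then obtain A B where X: "X = A \<times> B" and A[measurable]: "A \<in> sets MZ" and B[measurable]: "B \<in> sets MV"
      by blast
    have "emeasure ?N X = (\<integral>\<^sup>+z. emeasure (?k z) X \<partial>?D)"
      by (rule emeasure_bind[OF ne k]) (simp add: X)
    also have "\<dots> = (\<integral>\<^sup>+z. emeasure (\<kappa> z) B * indicator A z \<partial>?D)"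
    proof (rule nn_integral_cong)
      fix z assume "z \<in> space ?D"
      then have z: "z \<in> space MZ" by simp
      note [measurable_cong] = regular_cond_distr_kernel(2)[OF \<kappa> z]
      have sp: "space (\<kappa> z) = space MV" by (rule sets_eq_imp_space_eq) fact
      have "emeasure (?k z) X = emeasure (\<kappa> z) (Pair z -` (A \<times> B) \<inter> space (\<kappa> z))"
        unfolding X by (rule emeasure_distr) (use z in measurable)
      also have "Pair z -` (A \<times> B) \<inter> space (\<kappa> z) = (if z \<in> A then B else {})"
        using sets.sets_into_space[OF B] sp by auto
      finally show "emeasure (?k z) X = emeasure (\<kappa> z) B * indicator A z"
        by (simp split: if_splits)
    qed
    also have "\<dots> = emeasure P {w \<in> space P. Z w \<in> A \<and> V w \<in> B}"
      using \<kappa> A B by (simp add: regular_cond_distr_def)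
    also have "\<dots> = emeasure ?L X"
      unfolding X by (subst emeasure_distr) (auto intro!: arg_cong[where f="emeasure P"])
    finally show "emeasure ?L X = emeasure ?N X" by simp
  qed auto
qed

text \<open>Both facts come from the lifted kernel: integrals against it depend measurably on
  \<open>z\<close>, and the joint law is its bind, so integrals are iterated. The bound
  \<open>B\<close> supplies the boundedness that \<open>integral_bind\<close> asks for.\<close>

lemma
  fixes g :: "'z \<times> 'v \<Rightarrow> real"
  assumes P: "prob_space P" and Z[measurable]: "Z \<in> P \<rightarrow>\<^sub>M MZ" and V[measurable]: "V \<in> P \<rightarrow>\<^sub>M MV"
    and \<kappa>: "regular_cond_distr P MZ Z MV V \<kappa>"
    and g[measurable]: "g \<in> borel_measurable (MZ \<Otimes>\<^sub>M MV)"
  shows measurable_integral_regular_cond_distr: "(\<lambda>z. \<integral>v. g (z, v) \<partial>\<kappa> z) \<in> borel_measurable MZ"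
    and integral_regular_cond_distr: "(\<And>x. x \<in> space (MZ \<Otimes>\<^sub>M MV) \<Longrightarrow> \<bar>g x\<bar> \<le> B) \<Longrightarrow>
      (\<integral>w. g (Z w, V w) \<partial>P) = (\<integral>z. (\<integral>v. g (z, v) \<partial>\<kappa> z) \<partial>distr P MZ Z)"
proof -
  interpret P: prob_space P by fact
  let ?k = "\<lambda>z. distr (\<kappa> z) (MZ \<Otimes>\<^sub>M MV) (Pair z)"
  note k = measurable_kernel_Pair[OF measurable_regular_cond_distr[OF \<kappa>]]
  have inner: "(\<integral>x. g x \<partial>?k z) = (\<integral>v. g (z, v) \<partial>\<kappa> z)" if z: "z \<in> space MZ" for z
  proof -
    note [measurable_cong] = regular_cond_distr_kernel(2)[OF \<kappa> z]
    show ?thesis by (rule integral_distr) (use z in measurable)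
  qed
  have "(\<lambda>z. \<integral>x. g x \<partial>?k z) \<in> borel_measurable MZ"
    by (rule measurable_compose[OF k integral_measurable_subprob_algebra]) simp
  then show "(\<lambda>z. \<integral>v. g (z, v) \<partial>\<kappa> z) \<in> borel_measurable MZ"
    by (subst measurable_cong[OF inner[symmetric]])
  assume B: "\<And>x. x \<in> space (MZ \<Otimes>\<^sub>M MV) \<Longrightarrow> \<bar>g x\<bar> \<le> B"
  have fin: "finite_measure (distr P MZ Z)"
    by (rule P.finite_measure_distr) simp
  have "(\<integral>w. g (Z w, V w) \<partial>P) = (\<integral>x. g x \<partial>distr P (MZ \<Otimes>\<^sub>M MV) (\<lambda>w. (Z w, V w)))"
    by (rule integral_distr[symmetric]) measurable
  also have "\<dots> = (\<integral>z. (\<integral>x. g x \<partial>?k z) \<partial>distr P MZ Z)"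
    unfolding distr_Pair_eq_bind[OF P Z V \<kappa>]
  proof (rule integral_bind[OF g B _ fin, where B'=1])
    show "AE z in distr P MZ Z. emeasure (?k z) (space (?k z)) \<le> ennreal 1"
    proof (rule AE_I2)
      fix z assume "z \<in> space (distr P MZ Z)"
      then have "subprob_space (?k z)"
        using measurable_space[OF k, of z] by (simp add: space_subprob_algebra)
      from subprob_space.emeasure_space_le_1[OF this]
      show "emeasure (?k z) (space (?k z)) \<le> ennreal 1" by simp
    qed
  qed (use k in simp_all)
  also have "\<dots> = (\<integral>z. (\<integral>v. g (z, v) \<partial>\<kappa> z) \<partial>distr P MZ Z)"
    by (rule Bochner_Integration.integral_cong) (simp_all add: inner)
  finally show "(\<integral>w. g (Z w, V w) \<partial>P) = (\<integral>z. (\<integral>v. g (z, v) \<partial>\<kappa> z) \<partial>distr P MZ Z)" .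
qed

text \<open>This bridges two encodings of conditioning: conditional independence is phrased with
  \<open>real_cond_exp\<close>, divergences with kernels. The test sets for conditioning on
  \<open>Z\<close> are preimages under \<open>Z\<close>, and on these the required equality of
  integrals is the identity defining the kernel.\<close>

lemma real_cond_exp_indicator_eq_kernel:
  assumes P: "prob_space P" and Z[measurable]: "Z \<in> P \<rightarrow>\<^sub>M MZ" and V[measurable]: "V \<in> P \<rightarrow>\<^sub>M MV"
    and \<kappa>: "regular_cond_distr P MZ Z MV V \<kappa>" and B[measurable]: "B \<in> sets MV"
  shows "AE w in P. real_cond_exp P (vimage_algebra (space P) Z MZ) (indicator {w \<in> space P. V w \<in> B}) w
    = measure (\<kappa> (Z w)) B"
proof -
  interpret P: prob_space P by fact
  let ?F = "vimage_algebra (space P) Z MZ"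
  note \<kappa>m[measurable] = measurable_regular_cond_distr[OF \<kappa>]
  have Zs: "Z \<in> space P \<rightarrow> space MZ" using measurable_space[OF Z] by auto
  have sub: "subalgebra P ?F"
    unfolding subalgebra_def using sets_image_in_sets[OF refl Z] by simp
  interpret finite_measure_subalgebra P ?F by unfold_locales (fact sub)
  have mes: "(\<lambda>z. measure (\<kappa> z) B) \<in> borel_measurable MZ" by measurable
  have le1: "measure (\<kappa> (Z w)) B \<le> 1" if "w \<in> space P" for w
    using regular_cond_distr_kernel(1)[OF \<kappa>, of "Z w"] Zs that by (auto intro: prob_space.prob_le_1)
  have ik: "integrable P (\<lambda>w. measure (\<kappa> (Z w)) B)"
    by (rule P.integrable_const_bound[where B=1]) (use le1 mes in \<open>auto intro!: AE_I2\<close>)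
  show ?thesis
  proof (rule real_cond_exp_charact)
    fix A assume "A \<in> sets ?F"
    then obtain A' where A'[measurable]: "A' \<in> sets MZ" and A: "A = Z -` A' \<inter> space P"
      using sets_vimage_algebra2[OF Zs] by auto
    have [measurable]: "A \<in> sets P" unfolding A by simp
    have "ennreal (\<integral>w. indicator A w * measure (\<kappa> (Z w)) B \<partial>P) =
        (\<integral>\<^sup>+w. ennreal (indicator A w * measure (\<kappa> (Z w)) B) \<partial>P)"
      using integrable_mult_indicator[OF \<open>A \<in> sets P\<close> ik] by (intro nn_integral_eq_integral[symmetric]) auto
    also have "\<dots> = (\<integral>\<^sup>+w. emeasure (\<kappa> (Z w)) B * indicator A' (Z w) \<partial>P)"
    proof (rule nn_integral_cong)
      fix w assume w: "w \<in> space P"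
      interpret \<kappa>: prob_space "\<kappa> (Z w)"
        using regular_cond_distr_kernel(1)[OF \<kappa>] Zs w by auto
      show "ennreal (indicator A w * measure (\<kappa> (Z w)) B) = emeasure (\<kappa> (Z w)) B * indicator A' (Z w)"
        using w by (auto simp: A indicator_def \<kappa>.emeasure_eq_measure)
    qed
    also have "\<dots> = (\<integral>\<^sup>+z. emeasure (\<kappa> z) B * indicator A' z \<partial>distr P MZ Z)"
      by (rule nn_integral_distr[symmetric]) measurable
    also have "\<dots> = emeasure P {w \<in> space P. Z w \<in> A' \<and> V w \<in> B}"
      using \<kappa> A' B by (simp add: regular_cond_distr_def)
    also have "\<dots> = ennreal (measure P {w \<in> space P. Z w \<in> A' \<and> V w \<in> B})"
      by (rule P.emeasure_eq_measure)
    finally have "(\<integral>w. indicator A w * measure (\<kappa> (Z w)) B \<partial>P) = measure P {w \<in> space P. Z w \<in> A' \<and> V w \<in> B}"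
      by (subst (asm) ennreal_inj) (auto intro!: Bochner_Integration.integral_nonneg)
    also have "\<dots> = (\<integral>w. indicator {w \<in> space P. Z w \<in> A' \<and> V w \<in> B} w \<partial>P)"
      by simp
    also have "\<dots> = (\<integral>w. indicator A w * indicator {w \<in> space P. V w \<in> B} w \<partial>P)"
      by (rule Bochner_Integration.integral_cong) (auto simp: A indicator_def)
    finally show "(\<integral>w\<in>A. indicator {w \<in> space P. V w \<in> B} w \<partial>P) = (\<integral>w\<in>A. measure (\<kappa> (Z w)) B \<partial>P)"
      by (simp add: set_lebesgue_integral_def)
  next
    show "(\<lambda>w. measure (\<kappa> (Z w)) B) \<in> borel_measurable ?F"
      by (rule measurable_compose[OF measurable_vimage_algebra1[OF Zs] mes])
    show "integrable P (indicator {w \<in> space P. V w \<in> B} :: _ \<Rightarrow> real)"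
      by (rule integrable_real_indicator) (auto simp: less_top[symmetric])
  qed (rule ik)
qed

section \<open>Countable generators and the product form of the joint kernel\<close>

lemma standard_borel_countable_generator:
  assumes "standard_borel M"
  obtains E where "countable E" "Int_stable E" "space M \<in> E" "E \<subseteq> Pow (space M)"
    "sets M = sigma_sets (space M) E"
proof -
  from assms obtain T where T: "second_countable T" "space M = topspace T"
    "sets M = sigma_sets (topspace T) {U. openin T U}"
    unfolding standard_borel_def by blast
  from T(1) obtain \<B> where \<B>: "countable \<B>" "\<And>V. V \<in> \<B> \<Longrightarrow> openin T V"
    "\<And>U x. openin T U \<Longrightarrow> x \<in> U \<Longrightarrow> \<exists>V\<in>\<B>. x \<in> V \<and> V \<subseteq> U"
    unfolding second_countable_def by metis
  let ?S = "topspace T"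
  \<comment> \<open>Finite intersections of base sets remain countable in number and are closed
    under intersection. The choice \<open>F = {}\<close> contributes the whole space, thanks to the
    intersection with \<open>?S\<close>.\<close>
  define E where "E = (\<lambda>F. ?S \<inter> \<Inter>F) ` {F. finite F \<and> F \<subseteq> \<B>}"
  have openE: "openin T X" if "X \<in> E" for X
  proof -
    from that obtain F where "finite F" "F \<subseteq> \<B>" "X = ?S \<inter> \<Inter>F" by (auto simp: E_def)
    moreover have "openin T (?S \<inter> \<Inter>F)" if "finite F" "F \<subseteq> \<B>" for F
      using that
    proof (induction F)
      case (insert A F)
      have "?S \<inter> \<Inter>(insert A F) = A \<inter> (?S \<inter> \<Inter>F)" by auto
      then show ?case using insert \<B>(2) by (auto intro: openin_Int)
    qed auto
    ultimately show ?thesis by simp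
  qed
  show ?thesis
  proof
    show "countable E"
      unfolding E_def by (intro countable_image countable_Collect_finite_subset \<B>)
    show "Int_stable E"
    proof (rule Int_stableI)
      fix a b assume "a \<in> E" "b \<in> E"
      then obtain F G where "a = ?S \<inter> \<Inter>F" "finite F" "F \<subseteq> \<B>" "b = ?S \<inter> \<Inter>G" "finite G" "G \<subseteq> \<B>"
        by (auto simp: E_def)
      then show "a \<inter> b \<in> E"
        unfolding E_def by (intro image_eqI[of _ _ "F \<union> G"]) auto
    qed
    show "space M \<in> E"
      unfolding E_def T(2) by (rule image_eqI[of _ _ "{}"]) auto
    show sub: "E \<subseteq> Pow (space M)" by (auto simp: E_def T(2))
    interpret sigma_algebra ?S "sigma_sets ?S E"
      by (rule sigma_algebra_sigma_sets) (use sub T(2) in simp)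
    have "sigma_sets ?S {U. openin T U} = sigma_sets ?S E"
    proof (rule sigma_sets_eqI)
      fix U assume "U \<in> {U. openin T U}"
      then have U: "openin T U" by simp
      \<comment> \<open>Countability of the base makes this a countable union, which a generated
        \<sigma>-algebra contains.\<close>
      have "U = \<Union>{V \<in> \<B>. V \<subseteq> U}" using \<B>(3)[OF U] by blast
      moreover have "\<Union>{V \<in> \<B>. V \<subseteq> U} \<in> sigma_sets ?S E"
      proof (rule countable_Union)
        show "countable {V \<in> \<B>. V \<subseteq> U}" using \<B>(1) by (rule countable_subset[rotated]) auto
        have "V \<in> E" if "V \<in> \<B>" for V
          unfolding E_def using that openin_subset[OF \<B>(2)[OF that]]
          by (intro image_eqI[of _ _ "{V}"]) auto
        then show "{V \<in> \<B>. V \<subseteq> U} \<subseteq> sigma_sets ?S E" by auto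
      qed
      ultimately show "U \<in> sigma_sets ?S E" by simp
    next
      fix X assume "X \<in> E"
      then show "X \<in> sigma_sets ?S {U. openin T U}" using openE by auto
    qed
    then show "sets M = sigma_sets (space M) E" using T by simp
  qed
qed

text \<open>The null set in conditional independence may depend on the events. Boxes with sides in
  countable generators are countably many, so one null set serves them all; off it the two kernels
  agree on an intersection-stable generator of the product \<sigma>-algebra, hence
  everywhere.\<close>

lemma AE_kernel_eq_PiM:
  assumes P: "prob_space P" and I: "finite I" and sb: "\<And>i. i \<in> I \<Longrightarrow> standard_borel (MV i)"
    and Z[measurable]: "Z \<in> P \<rightarrow>\<^sub>M MZ" and Y[measurable]: "Y \<in> P \<rightarrow>\<^sub>M PiM I MV"
    and \<kappa>: "regular_cond_distr P MZ Z (PiM I MV) Y \<kappa>"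
    and \<kappa>i: "\<And>i. i \<in> I \<Longrightarrow> regular_cond_distr P MZ Z (MV i) (\<lambda>w. Y w i) (\<kappa>i i)"
    and ci: "cond_indep_vars P MZ Z MV (\<lambda>i w. Y w i) I"
  shows "AE z in distr P MZ Z. \<kappa> z = PiM I (\<lambda>i. \<kappa>i i z)"
proof -
  have "\<forall>i\<in>I. \<exists>E. countable E \<and> Int_stable E \<and> space (MV i) \<in> E \<and> E \<subseteq> Pow (space (MV i)) \<and>
    sets (MV i) = sigma_sets (space (MV i)) E"
  proof
    fix i assume i: "i \<in> I"
    show "\<exists>E. countable E \<and> Int_stable E \<and> space (MV i) \<in> E \<and> E \<subseteq> Pow (space (MV i)) \<and>
      sets (MV i) = sigma_sets (space (MV i)) E"
      by (rule standard_borel_countable_generator[OF sb[OF i]]) blast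
  qed
  then obtain E where E0: "\<forall>i\<in>I. countable (E i) \<and> Int_stable (E i) \<and> space (MV i) \<in> E i \<and>
    E i \<subseteq> Pow (space (MV i)) \<and> sets (MV i) = sigma_sets (space (MV i)) (E i)"
    by (rule bchoice[THEN exE])
  then have E: "\<And>i. i \<in> I \<Longrightarrow> countable (E i)" "\<And>i. i \<in> I \<Longrightarrow> Int_stable (E i)"
    "\<And>i. i \<in> I \<Longrightarrow> space (MV i) \<in> E i" "\<And>i. i \<in> I \<Longrightarrow> E i \<subseteq> Pow (space (MV i))"
    "\<And>i. i \<in> I \<Longrightarrow> sets (MV i) = sigma_sets (space (MV i)) (E i)"
    by simp_all
  have ES: "A \<in> sets (MV i)" if "i \<in> I" "A \<in> E i" for i A
    using E(5)[OF that(1)] that(2) by auto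
  let ?\<Omega> = "PiE I (\<lambda>i. space (MV i))"
  \<comment> \<open>The sides range over \<open>PiE I E\<close>, whose members are
    \<open>undefined\<close> outside \<open>I\<close>; this keeps the index set of the boxes
    countable.\<close>
  let ?R = "PiE I ` PiE I E"
  note [measurable] = measurable_regular_cond_distr[OF \<kappa>]
  have Yi: "(\<lambda>w. Y w i) \<in> P \<rightarrow>\<^sub>M MV i" if "i \<in> I" for i
    using that by measurable
  have PiE_sub: "PiE I A \<subseteq> ?\<Omega>" if "A \<in> PiE I E" for A
  proof (rule PiE_mono)
    fix i assume i: "i \<in> I"
    then have "A i \<in> E i" using that by (rule PiE_mem[rotated])
    then show "A i \<subseteq> space (MV i)" using E(4)[OF i] by blast
  qed
  have PiE_eq: "{f \<in> ?\<Omega>. \<forall>i\<in>I. f i \<in> A i} = PiE I A" if "PiE I A \<subseteq> ?\<Omega>" for A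
    using that by (simp add: PiE_iff set_eq_iff subset_iff) blast
  from PiE_sub have R_sub: "?R \<subseteq> Pow ?\<Omega>" by blast
  have sR: "sets (PiM I MV) = sigma_sets ?\<Omega> ?R"
  proof -
    have "sets (PiM I MV) = sets (PiM I (\<lambda>i. sigma (space (MV i)) (E i)))"
      by (rule sets_PiM_cong) (use E in auto)
    also have "\<dots> = sets (sigma ?\<Omega> {{f \<in> ?\<Omega>. \<forall>i\<in>j. f i \<in> A i} | A j. j \<in> {I} \<and> A \<in> Pi j E})"
    proof (rule sets_PiM_sigma)
      fix i assume i: "i \<in> I"
      show "\<exists>S\<subseteq>E i. countable S \<and> space (MV i) = \<Union>S"
        by (rule exI[of _ "{space (MV i)}"]) (simp add: E(3)[OF i])
      show "E i \<subseteq> Pow (space (MV i))" by (rule E(4)[OF i])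
    qed (use I in simp_all)
    also have "{{f \<in> ?\<Omega>. \<forall>i\<in>j. f i \<in> A i} | A j. j \<in> {I} \<and> A \<in> Pi j E} = ?R"
    proof (intro equalityI subsetI)
      fix X assume "X \<in> {{f \<in> ?\<Omega>. \<forall>i\<in>j. f i \<in> A i} | A j. j \<in> {I} \<and> A \<in> Pi j E}"
      then obtain A where A: "A \<in> Pi I E" and X: "X = {f \<in> ?\<Omega>. \<forall>i\<in>I. f i \<in> A i}" by auto
      have "restrict A I \<in> PiE I E" using A by auto
      moreover have "X = PiE I (restrict A I)"
        unfolding X PiE_eq[OF PiE_sub[OF calculation], symmetric] by auto
      ultimately show "X \<in> ?R" by blast
    next
      fix X assume "X \<in> ?R"
      then obtain A where A: "A \<in> PiE I E" and X: "X = PiE I A" by blast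
      have "X = {f \<in> ?\<Omega>. \<forall>i\<in>I. f i \<in> A i}"
        unfolding X by (rule PiE_eq[OF PiE_sub[OF A], symmetric])
      moreover have "A \<in> Pi I E" using A by (simp add: PiE_def)
      ultimately show "X \<in> {{f \<in> ?\<Omega>. \<forall>i\<in>j. f i \<in> A i} | A j. j \<in> {I} \<and> A \<in> Pi j E}"
        by blast
    qed
    also have "sets (sigma ?\<Omega> ?R) = sigma_sets ?\<Omega> ?R"
      by (rule sets_measure_of[OF R_sub])
    finally show ?thesis .
  qed
  have rect: "AE z in distr P MZ Z. measure (\<kappa> z) (PiE I A) = (\<Prod>i\<in>I. measure (\<kappa>i i z) (A i))"
    if A: "A \<in> PiE I E" for A
  proof -
    have As: "A i \<in> sets (MV i)" if "i \<in> I" for i using ES[OF that] A that by auto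
    then have AP: "PiE I A \<in> sets (PiM I MV)" using I by (auto intro!: sets_PiM_I_finite)
    let ?c = "\<lambda>X. real_cond_exp P (vimage_algebra (space P) Z MZ) (indicator X)"
    have set_eq: "{w \<in> space P. \<forall>i\<in>I. Y w i \<in> A i} = {w \<in> space P. Y w \<in> PiE I A}"
      using measurable_space[OF Y] by (auto simp: PiE_iff space_PiM)
    have m1: "(\<lambda>z. measure (\<kappa> z) (PiE I A)) \<in> borel_measurable MZ"
      using AP by measurable
    have mi: "(\<lambda>z. measure (\<kappa>i i z) (A i)) \<in> borel_measurable MZ" if "i \<in> I" for i
      using measurable_compose[OF measurable_regular_cond_distr[OF \<kappa>i[OF that]]
          measurable_measure_subprob_algebra[OF As[OF that]]] .
    have mp: "(\<lambda>z. \<Prod>i\<in>I. measure (\<kappa>i i z) (A i)) \<in> borel_measurable MZ"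
      by (rule borel_measurable_prod) (rule mi)
    \<comment> \<open>Each conditional probability in the factorisation is replaced by a kernel
      evaluated at \<open>Z w\<close>; the resulting identity depends on \<open>w\<close> only
      through \<open>Z w\<close> and passes to the law of \<open>Z\<close>.\<close>
    have "AE w in P. ?c {w \<in> space P. \<forall>i\<in>I. Y w i \<in> A i} w = (\<Prod>i\<in>I. ?c {w \<in> space P. Y w i \<in> A i} w)"
      using ci I As by (auto simp: cond_indep_vars_def)
    moreover have "AE w in P. ?c {w \<in> space P. \<forall>i\<in>I. Y w i \<in> A i} w = measure (\<kappa> (Z w)) (PiE I A)"
      unfolding set_eq by (rule real_cond_exp_indicator_eq_kernel[OF P Z Y \<kappa> AP])
    moreover have "AE w in P. \<forall>i\<in>I. ?c {w \<in> space P. Y w i \<in> A i} w = measure (\<kappa>i i (Z w)) (A i)"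
      by (intro AE_finite_allI I real_cond_exp_indicator_eq_kernel[OF P Z Yi \<kappa>i As])
    ultimately have "AE w in P. measure (\<kappa> (Z w)) (PiE I A) = (\<Prod>i\<in>I. measure (\<kappa>i i (Z w)) (A i))"
      by eventually_elim (simp cong: prod.cong)
    then show ?thesis
      by (subst AE_distr_iff[OF Z]) (use m1 mp in measurable)
  qed
  have "countable (PiE I E)" by (rule countable_PiE[OF I E(1)])
  then have "AE z in distr P MZ Z. \<forall>A\<in>PiE I E. measure (\<kappa> z) (PiE I A) = (\<Prod>i\<in>I. measure (\<kappa>i i z) (A i))"
    using rect by (subst AE_ball_countable) auto
  then show ?thesis
    using AE_space
  proof eventually_elim
    case (elim z)
    then have z: "z \<in> space MZ" by simp
    note ks = regular_cond_distr_kernel(2)[OF \<kappa> z] and kis = regular_cond_distr_kernel(2)[OF \<kappa>i z]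
    interpret \<kappa>: prob_space "\<kappa> z" by (rule regular_cond_distr_kernel(1)[OF \<kappa> z])
    have pr: "prob_space (\<kappa>i i z)" if "i \<in> I" for i
      by (rule regular_cond_distr_kernel(1)[OF \<kappa>i[OF that] z])
    have sP: "sets (PiM I (\<lambda>i. \<kappa>i i z)) = sets (PiM I MV)"
      by (rule sets_PiM_cong) (use kis in auto)
    show ?case
    proof (rule measure_eqI_generator_eq[where \<Omega>="?\<Omega>" and E="?R" and A="\<lambda>_. ?\<Omega>"])
      show "Int_stable ?R"
      proof (rule Int_stableI)
        fix a b assume "a \<in> ?R" "b \<in> ?R"
        then obtain A B where AB: "A \<in> PiE I E" "B \<in> PiE I E" "a = PiE I A" "b = PiE I B" by blast
        have "a \<inter> b = PiE I (\<lambda>i\<in>I. A i \<inter> B i)"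
          unfolding AB by (auto simp: PiE_iff)
        moreover have "(\<lambda>i\<in>I. A i \<inter> B i) \<in> PiE I E"
          using AB E(2) by (auto simp: PiE_iff Int_stable_def)
        ultimately show "a \<inter> b \<in> ?R" by blast
      qed
      show "?R \<subseteq> Pow ?\<Omega>" by (rule R_sub)
      show "sets (\<kappa> z) = sigma_sets ?\<Omega> ?R" using ks sR by simp
      show "sets (PiM I (\<lambda>i. \<kappa>i i z)) = sigma_sets ?\<Omega> ?R" using sP sR by simp
      \<comment> \<open>The whole space has to be a box in \<open>?R\<close> itself, which is why
        each \<open>E i\<close> was chosen to contain \<open>space (MV i)\<close>.\<close>
      have "?\<Omega> = PiE I (\<lambda>i\<in>I. space (MV i))" by (rule PiE_cong) simp
      moreover have "(\<lambda>i\<in>I. space (MV i)) \<in> PiE I E" using E(3) by auto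
      ultimately show "range (\<lambda>_. ?\<Omega>) \<subseteq> ?R" by blast
      show "emeasure (\<kappa> z) ?\<Omega> \<noteq> \<infinity>" by simp
    next
      fix X assume "X \<in> ?R"
      then obtain A where A: "A \<in> PiE I E" "X = PiE I A" by blast
      let ?e = "\<lambda>i. if i \<in> I then \<kappa>i i z else return (count_space UNIV) undefined"
      interpret e: product_prob_space ?e I
        by (intro product_prob_spaceI) (auto simp: pr prob_space_return)
      have PiMe: "PiM I ?e = PiM I (\<lambda>i. \<kappa>i i z)" by (rule PiM_cong) auto
      have "emeasure (PiM I ?e) (PiE I A) = (\<Prod>i\<in>I. emeasure (?e i) (A i))"
        using A kis by (intro e.emeasure_PiM I) (auto intro: ES)
      also have "\<dots> = (\<Prod>i\<in>I. ennreal (measure (\<kappa>i i z) (A i)))"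
      proof (rule prod.cong[OF refl])
        fix i assume i: "i \<in> I"
        interpret p: prob_space "\<kappa>i i z" by (rule pr[OF i])
        show "emeasure (?e i) (A i) = ennreal (measure (\<kappa>i i z) (A i))"
          using i by (simp add: p.emeasure_eq_measure)
      qed
      also have "\<dots> = ennreal (\<Prod>i\<in>I. measure (\<kappa>i i z) (A i))"
        by (rule prod_ennreal) simp
      also have "\<dots> = emeasure (\<kappa> z) (PiE I A)"
        using elim A by (simp add: \<kappa>.emeasure_eq_measure)
      finally show "emeasure (\<kappa> z) X = emeasure (PiM I (\<lambda>i. \<kappa>i i z)) X"
        by (simp add: A PiMe)
    qed auto
  qed
qed

section \<open>Loss gap\<close>

lemma (in prob_space) integral_in_interval:
  fixes f :: "'a \<Rightarrow> real"
  assumes f[measurable]: "f \<in> borel_measurable M" and B: "\<And>x. x \<in> space M \<Longrightarrow> 0 \<le> f x \<and> f x \<le> B"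
  shows "0 \<le> (\<integral>x. f x \<partial>M) \<and> (\<integral>x. f x \<partial>M) \<le> B"
proof
  have "integrable M f"
    by (rule integrable_const_bound[where B=B]) (use B in \<open>auto intro!: AE_I2\<close>)
  then show "(\<integral>x. f x \<partial>M) \<le> B"
    by (rule integral_le_const) (use B in \<open>auto intro!: AE_I2\<close>)
  show "0 \<le> (\<integral>x. f x \<partial>M)"
    by (rule Bochner_Integration.integral_nonneg) (use B in auto)
qed

text \<open>No measurability of the pointwise divergence is needed: by Pinsker's inequality it dominates
  a measurable function, so the bound holds for the lower integral that \<open>\<integral>\<^sup>+\<close> denotes on
  non-measurable functions.\<close>

lemma abs_integral_diff_kernels_le:
  fixes H :: "'z \<times> 'v \<Rightarrow> real"
  assumes P: "prob_space P" and Q: "prob_space Q"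
    and ZP: "Z \<in> P \<rightarrow>\<^sub>M MZ" and YP: "Y \<in> P \<rightarrow>\<^sub>M MV" and ZQ: "Z \<in> Q \<rightarrow>\<^sub>M MZ" and YQ: "Y \<in> Q \<rightarrow>\<^sub>M MV"
    and DP: "distr P MZ Z = D" and DQ: "distr Q MZ Z = D"
    and \<kappa>P: "regular_cond_distr P MZ Z MV Y \<kappa>P" and \<kappa>Q: "regular_cond_distr Q MZ Z MV Y \<kappa>Q"
    and H[measurable]: "H \<in> borel_measurable (MZ \<Otimes>\<^sub>M MV)"
    and HB: "\<And>x. x \<in> space (MZ \<Otimes>\<^sub>M MV) \<Longrightarrow> 0 \<le> H x \<and> H x \<le> B"
  shows "ennreal \<bar>(\<integral>w. H (Z w, Y w) \<partial>Q) - (\<integral>w. H (Z w, Y w) \<partial>P)\<bar> \<le>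
    ennreal B * ennreal_sqrt (1 / 2 * (\<integral>\<^sup>+z. KL_div (\<kappa>P z) (\<kappa>Q z) \<partial>D))"
proof -
  interpret P: prob_space P by fact
  interpret D: prob_space D unfolding DP[symmetric] by (rule P.prob_space_distr[OF ZP])
  have spD: "space D = space MZ" and sD[measurable_cong]: "sets D = sets MZ"
    by (auto simp: DP[symmetric])
  define a where "a z = (\<integral>v. H (z, v) \<partial>\<kappa>P z)" for z
  define b where "b z = (\<integral>v. H (z, v) \<partial>\<kappa>Q z)" for z
  have [measurable]: "a \<in> borel_measurable MZ" "b \<in> borel_measurable MZ"
    unfolding a_def b_def
    using measurable_integral_regular_cond_distr[OF P ZP YP \<kappa>P H]
      measurable_integral_regular_cond_distr[OF Q ZQ YQ \<kappa>Q H] by auto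
  have Habs: "\<bar>H x\<bar> \<le> B" if "x \<in> space (MZ \<Otimes>\<^sub>M MV)" for x
    using HB[OF that] by simp
  have intP: "(\<integral>w. H (Z w, Y w) \<partial>P) = (\<integral>z. a z \<partial>D)"
    using integral_regular_cond_distr[OF P ZP YP \<kappa>P H Habs] by (simp add: a_def DP)
  have intQ: "(\<integral>w. H (Z w, Y w) \<partial>Q) = (\<integral>z. b z \<partial>D)"
    using integral_regular_cond_distr[OF Q ZQ YQ \<kappa>Q H Habs] by (simp add: b_def DQ)
  have Hz: "(\<lambda>v. H (z, v)) \<in> borel_measurable MV" if "z \<in> space MZ" for z
    using that by measurable
  have Hzb: "0 \<le> H (z, v) \<and> H (z, v) \<le> B" if "z \<in> space MZ" "v \<in> space MV" for z v
    using HB[of "(z, v)"] that by (simp add: space_pair_measure)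
  have bounds: "0 \<le> a z \<and> a z \<le> B" "0 \<le> b z \<and> b z \<le> B" if z: "z \<in> space MZ" for z
  proof -
    have s: "sets (\<kappa>P z) = sets MV" "sets (\<kappa>Q z) = sets MV"
      using regular_cond_distr_kernel(2)[OF \<kappa>P z] regular_cond_distr_kernel(2)[OF \<kappa>Q z] by auto
    note sp = s[THEN sets_eq_imp_space_eq]
    show "0 \<le> a z \<and> a z \<le> B" unfolding a_def
      by (rule prob_space.integral_in_interval[OF regular_cond_distr_kernel(1)[OF \<kappa>P z]])
         (use Hz[OF z] Hzb[OF z] sp in \<open>simp_all cong: measurable_cong_sets[OF s(1) refl]\<close>)
    show "0 \<le> b z \<and> b z \<le> B" unfolding b_def
      by (rule prob_space.integral_in_interval[OF regular_cond_distr_kernel(1)[OF \<kappa>Q z]])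
         (use Hz[OF z] Hzb[OF z] sp in \<open>simp_all cong: measurable_cong_sets[OF s(2) refl]\<close>)
  qed
  \<comment> \<open>Nonnegativity of \<open>B\<close> is read off at a single point, which exists
    because \<open>D\<close> is a probability measure.\<close>
  obtain z0 where "z0 \<in> space MZ" using D.not_empty spD by auto
  then have B0: "0 \<le> B" using bounds(1) by force
  let ?K = "\<integral>\<^sup>+z. KL_div (\<kappa>P z) (\<kappa>Q z) \<partial>D"
  let ?f = "\<lambda>z. a z - b z"
  let ?u = "\<integral>z. ?f z \<partial>D"
  have fb: "\<bar>?f z\<bar> \<le> B" if "z \<in> space MZ" for z
    using bounds[OF that] by auto
  have ia: "integrable D a" "integrable D b"
    by (rule D.integrable_const_bound[where B=B]; use bounds spD in \<open>auto intro!: AE_I2\<close>)+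
  have i_f: "integrable D ?f" using ia by simp
  have if2: "integrable D (\<lambda>z. (?f z)\<^sup>2)"
    by (rule D.integrable_const_bound[where B="B\<^sup>2"])
       (use fb spD in \<open>auto intro!: AE_I2 simp: abs_le_square_iff[symmetric] B0\<close>)
  \<comment> \<open>Jensen's inequality for the square, in the form that a variance is
    nonnegative.\<close>
  have u2: "?u\<^sup>2 \<le> (\<integral>z. (?f z)\<^sup>2 \<partial>D)"
    using D.variance_positive[of ?f] D.variance_eq[OF i_f if2] by simp
  have eq: "\<bar>(\<integral>w. H (Z w, Y w) \<partial>Q) - (\<integral>w. H (Z w, Y w) \<partial>P)\<bar> = \<bar>?u\<bar>"
    unfolding intP intQ using ia by (simp add: abs_minus_commute)
  have half: "1 / 2 = ennreal (1 / 2)"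
    by (simp add: divide_ennreal[symmetric] ennreal_numeral del: ennreal_half)
  \<comment> \<open>The case \<open>B = 0\<close> is separate for two reasons: Pinsker's inequality
    divides by \<open>B\<^sup>2\<close>, and \<open>0 * \<infinity> = 0\<close> in
    \<open>ennreal\<close>, so an infinite divergence makes the right side infinite only for
    \<open>B > 0\<close>.\<close>
  show ?thesis
  proof (cases "B = 0")
    case True
    then have "AE z in D. ?f z = 0" using fb spD by (auto intro!: AE_I2)
    then have "?u = 0" by (rule integral_eq_zero_AE)
    then show ?thesis by (simp add: eq)
  next
    case False
    with B0 have B: "0 < B" by simp
    have pinsker: "ennreal (2 * (?f z)\<^sup>2 / B\<^sup>2) \<le> KL_div (\<kappa>P z) (\<kappa>Q z)" if z: "z \<in> space MZ" for z
    proof -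
      have s: "sets (\<kappa>P z) = sets MV" "sets (\<kappa>Q z) = sets MV"
        using regular_cond_distr_kernel(2)[OF \<kappa>P z] regular_cond_distr_kernel(2)[OF \<kappa>Q z] by auto
      show ?thesis unfolding a_def b_def
      proof (rule Pinsker_bounded[OF regular_cond_distr_kernel(1)[OF \<kappa>P z] regular_cond_distr_kernel(1)[OF \<kappa>Q z] _ _ _ B])
        show "(\<lambda>v. H (z, v)) \<in> borel_measurable (\<kappa>Q z)"
          using Hz[OF z] by (simp cong: measurable_cong_sets[OF s(2) refl])
      qed (use Hzb[OF z] s sets_eq_imp_space_eq[OF s(2)] in auto)
    qed
    have "ennreal (2 * ?u\<^sup>2 / B\<^sup>2) \<le> ennreal (\<integral>z. 2 * (?f z)\<^sup>2 / B\<^sup>2 \<partial>D)"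
      using u2 B by (intro ennreal_leI) (simp add: divide_right_mono)
    also have "\<dots> = (\<integral>\<^sup>+z. ennreal (2 * (?f z)\<^sup>2 / B\<^sup>2) \<partial>D)"
      using if2 by (intro nn_integral_eq_integral[symmetric]) auto
    also have "\<dots> \<le> ?K"
      by (intro nn_integral_mono pinsker) (simp add: spD)
    finally have le: "ennreal (2 * ?u\<^sup>2 / B\<^sup>2) \<le> ?K" .
    show ?thesis
    proof (cases "?K = \<infinity>")
      case True
      have "ennreal_sqrt (1 / 2 * ?K) = \<infinity>"
        unfolding True half by (simp add: ennreal_sqrt_def ennreal_mult_top)
      then show ?thesis using B by (simp add: ennreal_mult_top)
    next
      case False
      then obtain k where k: "0 \<le> k" "?K = ennreal k" by (cases ?K) auto
      have "2 * ?u\<^sup>2 / B\<^sup>2 \<le> k" using le k by simp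
      then have "?u\<^sup>2 \<le> B\<^sup>2 * (k / 2)" using B by (simp add: field_simps)
      then have "sqrt (?u\<^sup>2) \<le> sqrt (B\<^sup>2 * (k / 2))" by (rule real_sqrt_le_mono)
      then have "\<bar>?u\<bar> \<le> B * sqrt (k / 2)" using B unfolding real_sqrt_mult by simp
      moreover have "1 / 2 * ?K = ennreal (k / 2)"
        unfolding k half using k by (simp add: ennreal_mult'[symmetric] del: ennreal_half)
      then have "ennreal_sqrt (1 / 2 * ?K) = ennreal (sqrt (k / 2))"
        using k by (simp add: ennreal_sqrt_def)
      ultimately show ?thesis
        unfolding eq using B k by (simp add: ennreal_mult'[symmetric] ennreal_leI)
    qed
  qed
qed

theorem theorem1:
  fixes MX :: "'x measure" and MK :: "'k measure"
    and MY :: "nat \<Rightarrow> 'y measure" and MC :: "'c measure"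
    and m :: nat
    and p_obs p_tgt :: "('x \<times> 'k \<times> (nat \<Rightarrow> 'y) \<times> 'c) measure"
    and p_XK :: "('x \<times> 'k) measure"
    and kC :: "'x \<times> 'k \<times> (nat \<Rightarrow> 'y) \<Rightarrow> 'c measure"
    and Y_obs Y_tgt :: "'x \<times> 'k \<Rightarrow> (nat \<Rightarrow> 'y) measure"
    and Yj_obs Yj_tgt :: "nat \<Rightarrow> 'x \<times> 'k \<Rightarrow> 'y measure"
    and L :: "'c \<Rightarrow> 'param \<Rightarrow> real" and \<theta> :: 'param and L_max :: real
  defines "MYs \<equiv> PiM {1..m} MY"
  defines "XK \<equiv> \<lambda>(x::'x, k::'k, y::nat \<Rightarrow> 'y, c::'c). (x, k)"
  defines "XKY \<equiv> \<lambda>(x::'x, k::'k, y::nat \<Rightarrow> 'y, c::'c). (x, k, y)"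
  defines "Y \<equiv> \<lambda>(x::'x, k::'k, y::nat \<Rightarrow> 'y, c::'c). y"
  defines "C \<equiv> \<lambda>(x::'x, k::'k, y::nat \<Rightarrow> 'y, c::'c). c"
  defines "L_train \<equiv> (\<integral>w. L (C w) \<theta> \<partial>p_obs)"
  defines "L_tgt \<equiv> (\<integral>w. L (C w) \<theta> \<partial>p_tgt)"
  defines "CI \<equiv> \<lambda>j z. KL_div (Yj_obs j z) (Yj_tgt j z)"
  assumes "standard_borel MX" and "standard_borel MK" and "standard_borel MC"
    and "\<And>j. j \<in> {1..m} \<Longrightarrow> standard_borel (MY j)"
    and "prob_space p_obs" and "sets p_obs = sets (MX \<Otimes>\<^sub>M MK \<Otimes>\<^sub>M MYs \<Otimes>\<^sub>M MC)"
    and "prob_space p_tgt" and "sets p_tgt = sets (MX \<Otimes>\<^sub>M MK \<Otimes>\<^sub>M MYs \<Otimes>\<^sub>M MC)"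
    and "distr p_obs (MX \<Otimes>\<^sub>M MK) XK = p_XK" and "distr p_tgt (MX \<Otimes>\<^sub>M MK) XK = p_XK"
    and "(\<lambda>c. L c \<theta>) \<in> borel_measurable MC"
    and "\<And>c. c \<in> space MC \<Longrightarrow> 0 \<le> L c \<theta> \<and> L c \<theta> \<le> L_max"
    and "regular_cond_distr p_obs (MX \<Otimes>\<^sub>M MK \<Otimes>\<^sub>M MYs) XKY MC C kC"
    and "regular_cond_distr p_tgt (MX \<Otimes>\<^sub>M MK \<Otimes>\<^sub>M MYs) XKY MC C kC"
    and "regular_cond_distr p_obs (MX \<Otimes>\<^sub>M MK) XK MYs Y Y_obs"
    and "regular_cond_distr p_tgt (MX \<Otimes>\<^sub>M MK) XK MYs Y Y_tgt"
    and "\<And>j. j \<in> {1..m} \<Longrightarrow>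
           regular_cond_distr p_obs (MX \<Otimes>\<^sub>M MK) XK (MY j) (\<lambda>w. Y w j) (Yj_obs j)"
    and "\<And>j. j \<in> {1..m} \<Longrightarrow>
           regular_cond_distr p_tgt (MX \<Otimes>\<^sub>M MK) XK (MY j) (\<lambda>w. Y w j) (Yj_tgt j)"
  shows "ennreal \<bar>L_tgt - L_train\<bar> \<le>
           2 * ennreal L_max * ennreal_sqrt (1 / 2 * (\<integral>\<^sup>+z. KL_div (Y_obs z) (Y_tgt z) \<partial>p_XK))
       \<and> (cond_indep_vars p_obs (MX \<Otimes>\<^sub>M MK) XK MY (\<lambda>j w. Y w j) {1..m} \<and>
          cond_indep_vars p_tgt (MX \<Otimes>\<^sub>M MK) XK MY (\<lambda>j w. Y w j) {1..m} \<longrightarrow>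
            (AE z in p_XK. KL_div (Y_obs z) (Y_tgt z) = (\<Sum>j=1..m. CI j z)) \<and>
            ennreal \<bar>L_tgt - L_train\<bar> \<le>
              2 * ennreal L_max * ennreal_sqrt (1 / 2 * (\<integral>\<^sup>+z. (\<Sum>j=1..m. CI j z) \<partial>p_XK)))"
proof -
  note P = \<open>prob_space p_obs\<close> and Q = \<open>prob_space p_tgt\<close>
  note sP[measurable_cong] = \<open>sets p_obs = sets (MX \<Otimes>\<^sub>M MK \<Otimes>\<^sub>M MYs \<Otimes>\<^sub>M MC)\<close>
  note sQ[measurable_cong] = \<open>sets p_tgt = sets (MX \<Otimes>\<^sub>M MK \<Otimes>\<^sub>M MYs \<Otimes>\<^sub>M MC)\<close>
  note DP = \<open>distr p_obs (MX \<Otimes>\<^sub>M MK) XK = p_XK\<close> and DQ = \<open>distr p_tgt (MX \<Otimes>\<^sub>M MK) XK = p_XK\<close>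
  note L[measurable] = \<open>(\<lambda>c. L c \<theta>) \<in> borel_measurable MC\<close>
  note LB = \<open>\<And>c. c \<in> space MC \<Longrightarrow> 0 \<le> L c \<theta> \<and> L c \<theta> \<le> L_max\<close>
  note kP = \<open>regular_cond_distr p_obs (MX \<Otimes>\<^sub>M MK \<Otimes>\<^sub>M MYs) XKY MC C kC\<close>
  note kQ = \<open>regular_cond_distr p_tgt (MX \<Otimes>\<^sub>M MK \<Otimes>\<^sub>M MYs) XKY MC C kC\<close>
  note yP = \<open>regular_cond_distr p_obs (MX \<Otimes>\<^sub>M MK) XK MYs Y Y_obs\<close>
  note yQ = \<open>regular_cond_distr p_tgt (MX \<Otimes>\<^sub>M MK) XK MYs Y Y_tgt\<close>
  have meas: "XK \<in> M \<rightarrow>\<^sub>M MX \<Otimes>\<^sub>M MK" "XKY \<in> M \<rightarrow>\<^sub>M MX \<Otimes>\<^sub>M MK \<Otimes>\<^sub>M MYs" "Y \<in> M \<rightarrow>\<^sub>M MYs" "C \<in> M \<rightarrow>\<^sub>M MC"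
    if [measurable_cong]: "sets M = sets (MX \<Otimes>\<^sub>M MK \<Otimes>\<^sub>M MYs \<Otimes>\<^sub>M MC)" for M
    unfolding XK_def XKY_def Y_def C_def by measurable
  \<comment> \<open>The conditional mean loss given \<open>(x, k, y)\<close>. It is the same
    function under both laws because \<open>kC\<close> is common, and this removes \<open>C\<close>
    from the comparison.\<close>
  define h where "h u = (\<integral>c. L c \<theta> \<partial>kC u)" for u
  \<comment> \<open>The same function with regrouped arguments: the kernels for \<open>Y\<close> are
    indexed by the pair \<open>(x, k)\<close>, whereas \<open>kC\<close> takes the triple.\<close>
  define H where "H = (\<lambda>(z, y). h (fst z, snd z, y))"
  have g: "(\<lambda>x. L (snd x) \<theta>) \<in> borel_measurable ((MX \<Otimes>\<^sub>M MK \<Otimes>\<^sub>M MYs) \<Otimes>\<^sub>M MC)"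
    by measurable
  have gB: "\<bar>L (snd x) \<theta>\<bar> \<le> L_max" if "x \<in> space ((MX \<Otimes>\<^sub>M MK \<Otimes>\<^sub>M MYs) \<Otimes>\<^sub>M MC)" for x
    using LB[of "snd x"] that by (auto simp: space_pair_measure)
  have h[measurable]: "h \<in> borel_measurable (MX \<Otimes>\<^sub>M MK \<Otimes>\<^sub>M MYs)"
    using measurable_integral_regular_cond_distr[OF P meas(2,4)[OF sP] kP g] by (simp add: h_def[abs_def])
  have hB: "0 \<le> h u \<and> h u \<le> L_max" if u: "u \<in> space (MX \<Otimes>\<^sub>M MK \<Otimes>\<^sub>M MYs)" for u
  proof -
    note s = regular_cond_distr_kernel(2)[OF kP u]
    show ?thesis unfolding h_def
      by (rule prob_space.integral_in_interval[OF regular_cond_distr_kernel(1)[OF kP u]])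
         (use L LB sets_eq_imp_space_eq[OF s] in \<open>simp_all cong: measurable_cong_sets[OF s refl]\<close>)
  qed
  have H[measurable]: "H \<in> borel_measurable ((MX \<Otimes>\<^sub>M MK) \<Otimes>\<^sub>M MYs)"
    unfolding H_def by measurable
  have HB: "0 \<le> H x \<and> H x \<le> L_max" if "x \<in> space ((MX \<Otimes>\<^sub>M MK) \<Otimes>\<^sub>M MYs)" for x
    using that hB by (auto simp: H_def space_pair_measure)
  \<comment> \<open>The tower property, for a general law \<open>M\<close> so that it serves both
    mechanisms.\<close>
  have loss: "(\<integral>w. L (C w) \<theta> \<partial>M) = (\<integral>w. H (XK w, Y w) \<partial>M)"
    if M: "prob_space M" and s: "sets M = sets (MX \<Otimes>\<^sub>M MK \<Otimes>\<^sub>M MYs \<Otimes>\<^sub>M MC)"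
      and k: "regular_cond_distr M (MX \<Otimes>\<^sub>M MK \<Otimes>\<^sub>M MYs) XKY MC C kC" for M
  proof -
    have "(\<integral>w. L (C w) \<theta> \<partial>M) = (\<integral>u. h u \<partial>distr M (MX \<Otimes>\<^sub>M MK \<Otimes>\<^sub>M MYs) XKY)"
      using integral_regular_cond_distr[OF M meas(2,4)[OF s] k g gB] by (simp add: h_def)
    also have "\<dots> = (\<integral>w. h (XKY w) \<partial>M)"
      by (rule integral_distr[OF meas(2)[OF s] h])
    also have "\<dots> = (\<integral>w. H (XK w, Y w) \<partial>M)"
      by (simp add: H_def XK_def XKY_def Y_def case_prod_beta)
    finally show ?thesis .
  qed
  have "ennreal \<bar>L_tgt - L_train\<bar> \<le>
      ennreal L_max * ennreal_sqrt (1 / 2 * (\<integral>\<^sup>+z. KL_div (Y_obs z) (Y_tgt z) \<partial>p_XK))"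
    unfolding L_tgt_def L_train_def loss[OF P sP kP] loss[OF Q sQ kQ]
    by (rule abs_integral_diff_kernels_le[OF P Q meas(1,3)[OF sP] meas(1,3)[OF sQ] DP DQ yP yQ H HB])
  \<comment> \<open>The argument yields the constant \<open>L_max\<close>, since a loss in
    \<open>[0, L_max]\<close> has range of length \<open>L_max\<close>; the factor 2 enters by
    monotonicity.\<close>
  also have "\<dots> \<le> 2 * ennreal L_max * ennreal_sqrt (1 / 2 * (\<integral>\<^sup>+z. KL_div (Y_obs z) (Y_tgt z) \<partial>p_XK))"
    using mult_right_mono[of 1 "2::ennreal"] by (intro mult_right_mono) simp_all
  finally have bound: "ennreal \<bar>L_tgt - L_train\<bar> \<le>
      2 * ennreal L_max * ennreal_sqrt (1 / 2 * (\<integral>\<^sup>+z. KL_div (Y_obs z) (Y_tgt z) \<partial>p_XK))" .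
  have decomp: "AE z in p_XK. KL_div (Y_obs z) (Y_tgt z) = (\<Sum>j=1..m. CI j z)"
    if ciP: "cond_indep_vars p_obs (MX \<Otimes>\<^sub>M MK) XK MY (\<lambda>j w. Y w j) {1..m}"
      and ciQ: "cond_indep_vars p_tgt (MX \<Otimes>\<^sub>M MK) XK MY (\<lambda>j w. Y w j) {1..m}"
  proof -
    note sb = \<open>\<And>j. j \<in> {1..m} \<Longrightarrow> standard_borel (MY j)\<close>
    note yjP = \<open>\<And>j. j \<in> {1..m} \<Longrightarrow> regular_cond_distr p_obs (MX \<Otimes>\<^sub>M MK) XK (MY j) (\<lambda>w. Y w j) (Yj_obs j)\<close>
    note yjQ = \<open>\<And>j. j \<in> {1..m} \<Longrightarrow> regular_cond_distr p_tgt (MX \<Otimes>\<^sub>M MK) XK (MY j) (\<lambda>w. Y w j) (Yj_tgt j)\<close>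
    have "AE z in p_XK. Y_obs z = PiM {1..m} (\<lambda>j. Yj_obs j z)"
      unfolding DP[symmetric]
      by (rule AE_kernel_eq_PiM[OF P _ sb meas(1)[OF sP] meas(3)[OF sP, unfolded MYs_def] yP[unfolded MYs_def] yjP ciP]) simp
    moreover have "AE z in p_XK. Y_tgt z = PiM {1..m} (\<lambda>j. Yj_tgt j z)"
      unfolding DQ[symmetric]
      by (rule AE_kernel_eq_PiM[OF Q _ sb meas(1)[OF sQ] meas(3)[OF sQ, unfolded MYs_def] yQ[unfolded MYs_def] yjQ ciQ]) simp
    \<comment> \<open>Both kernel identities hold almost everywhere under the same law
      \<open>p_XK\<close>, hence simultaneously at almost every \<open>z\<close>, where additivity
      over product measures applies.\<close>
    ultimately show ?thesis
      using AE_space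
    proof eventually_elim
      case (elim z)
      from elim(3) have z: "z \<in> space (MX \<Otimes>\<^sub>M MK)" by (simp add: DP[symmetric])
      have "KL_div (PiM {1..m} (\<lambda>j. Yj_obs j z)) (PiM {1..m} (\<lambda>j. Yj_tgt j z)) =
          (\<Sum>j=1..m. KL_div (Yj_obs j z) (Yj_tgt j z))"
      proof (rule KL_div_PiM)
        fix j assume j: "j \<in> {1..m}"
        show "prob_space (Yj_obs j z)" "prob_space (Yj_tgt j z)" "sets (Yj_obs j z) = sets (Yj_tgt j z)"
          using regular_cond_distr_kernel[OF yjP[OF j] z] regular_cond_distr_kernel[OF yjQ[OF j] z] by simp_all
      qed simp
      then show ?case by (simp only: elim(1,2) CI_def)
    qed
  qed
  show ?thesis
  proof (intro conjI impI)
    show "ennreal \<bar>L_tgt - L_train\<bar> \<le>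
        2 * ennreal L_max * ennreal_sqrt (1 / 2 * (\<integral>\<^sup>+z. KL_div (Y_obs z) (Y_tgt z) \<partial>p_XK))"
      by (rule bound)
  next
    assume ci: "cond_indep_vars p_obs (MX \<Otimes>\<^sub>M MK) XK MY (\<lambda>j w. Y w j) {1..m} \<and>
      cond_indep_vars p_tgt (MX \<Otimes>\<^sub>M MK) XK MY (\<lambda>j w. Y w j) {1..m}"
    then show ae: "AE z in p_XK. KL_div (Y_obs z) (Y_tgt z) = (\<Sum>j=1..m. CI j z)"
      using decomp by blast
    show "ennreal \<bar>L_tgt - L_train\<bar> \<le>
        2 * ennreal L_max * ennreal_sqrt (1 / 2 * (\<integral>\<^sup>+z. (\<Sum>j=1..m. CI j z) \<partial>p_XK))"
      using bound nn_integral_cong_AE[OF ae] by simp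
  qed
qed

end
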